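(* Let $\kappa>0$, $h>0$. Let $(A,B)$ be a random vector with $A\ge0$ and $\mathbf{E}A^\kappa=\theta\in(0,1)$, such that the distribution of $\log A$ conditioned on $A\ne0$ is arithmetic with span $h$. Let $F_\kappa$ be the (normalized) tilted distribution function of $\log A$ and $p_n=F_\kappa(nh)-F_\kappa(nh-)$, $n\in\mathbb{Z}$. Assume that $F_\kappa$ is $h$-subexponential, $F_\kappa\in\mathcal{S}_h$, that $\sup_{k\ge n}p_k=O(p_n)$ as $n\to\infty$, and that $\mathbf{E}|B|^\nu<\infty$ for some $\nu>\kappa$. Let $X$ be the unique (in distribution) solution of $X\stackrel{\mathcal{D}}{=}AX+B$, where $(A,B)$ and $X$ on the right-hand side are independent. Then there exist functions $q_1,q_2\in\mathcal{Q}_{\kappa,h}$ such that $$\lim_{n\to\infty}p_n^{-1}\,x^\kappa e^{\kappa nh}\,\mathbf{P}\{X>xe^{nh}\}=q_1(x),\qquad x\in C_{q_1},$$ $$\lim_{n\to\infty}p_n^{-1}\,x^\kappa e^{\kappa nh}\,\mathbf{P}\{X<-xe^{nh}\}=q_2(x),\qquad x\in C_{q_2}.$$ If $\mathbf{P}\{Ax+B=x\}<1$ for every $x\in\mathbb{R}$, then $q_1(x)+q_2(x)>0$ for all $x>0$.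
   Context: $\stackrel{\mathcal{D}}{=}$ is equality in distribution. A random variable $Y$ (or its distribution) is arithmetic if $Y\in h\mathbb{Z}$ a.s. for some $h>0$; the largest such $h$ is the span of $Y$. For $A\ge0$ with $\mathbf{E}A^\kappa=\theta\in(0,1)$, the (normalized) tilted distribution function of $\log A$ is $F_\kappa(x)=\theta^{-1}\mathbf{E}[I(\log A\le x)A^\kappa]$ (the event $A=0$ contributes $0$), where $I$ denotes the indicator. Let $H$ be the distribution function of an arithmetic random variable with span $h$; put $p_k=H(kh)-H(kh-)$ and $p_k^{*2}=(H*H)(kh)-(H*H)(kh-)$, $k\in\mathbb{Z}$. $H$ is called $h$-subexponential, $H\in\mathcal{S}_h$, if $p_{n+1}\sim p_n$ and $p_n^{*2}\sim2p_n$ as $n\to\infty$. For $\kappa,h>0$, $\mathcal{Q}_{\kappa,h}$ denotes the set of functions $q:(0,\infty)\to[0,\infty)$ such that $x^{-\kappa}q(x)$ is nonincreasing and $q(xe^h)=q(x)$ for all $x>0$. $C_q$ denotes the set of continuity points of $q$. *)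

theory Defs
  imports "HOL-Probability.Probability"
begin

text \<open>\<^term>\<open>arithmetic_span N h\<close>: the distribution \<open>N\<close> on the real line is arithmetic and its span
  is \<open>h\<close>. The unit mass at 0 is concentrated on every lattice, so it has no span in this sense.\<close>

definition concentrated_on_lattice :: "real measure \<Rightarrow> real \<Rightarrow> bool" where
  "concentrated_on_lattice N h \<longleftrightarrow> (AE y in N. \<exists>k::int. y = of_int k * h)"

definition arithmetic_span :: "real measure \<Rightarrow> real \<Rightarrow> bool" where
  "arithmetic_span N h \<longleftrightarrow>
     h > 0 \<and> concentrated_on_lattice N h \<and>
     (\<forall>h'>0. concentrated_on_lattice N h' \<longrightarrow> h' \<le> h)"

definition log_distr_nonzero :: "'a measure \<Rightarrow> ('a \<Rightarrow> real) \<Rightarrow> real measure" where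
  "log_distr_nonzero M A =
     distr (uniform_measure M {\<omega> \<in> space M. A \<omega> \<noteq> 0}) borel (\<lambda>\<omega>. ln (A \<omega>))"

text \<open>Where \<open>A\<close> vanishes, the integrand below is 0 because \<open>0 powr \<kappa> = 0\<close>; the value of
  \<open>ln 0\<close> is irrelevant.\<close>

definition tilted_cdf :: "'a measure \<Rightarrow> ('a \<Rightarrow> real) \<Rightarrow> real \<Rightarrow> real \<Rightarrow> real" where
  "tilted_cdf M A \<kappa> x =
     (\<integral>\<omega>. indicator {\<omega>. ln (A \<omega>) \<le> x} \<omega> * A \<omega> powr \<kappa> \<partial>M) / (\<integral>\<omega>. A \<omega> powr \<kappa> \<partial>M)"

definition lattice_mass :: "real \<Rightarrow> (real \<Rightarrow> real) \<Rightarrow> int \<Rightarrow> real" where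
  "lattice_mass h H k = H (of_int k * h) - Lim (at_left (of_int k * h)) H"

definition cdf_convolution :: "(real \<Rightarrow> real) \<Rightarrow> (real \<Rightarrow> real) \<Rightarrow> real \<Rightarrow> real" where
  "cdf_convolution F G = cdf (convolution (interval_measure F) (interval_measure G))"

text \<open>Asymptotic equivalence is expressed by quotients tending to a nonzero limit. As \<open>x / 0 = 0\<close>,
  this forces the masses to be eventually nonzero; the relation \<^const>\<open>asymp_equiv\<close> would also
  accept masses that vanish eventually.\<close>

definition lattice_subexponential :: "real \<Rightarrow> (real \<Rightarrow> real) \<Rightarrow> bool" where
  "lattice_subexponential h H \<longleftrightarrow>
     (\<exists>N. real_distribution N \<and> H = cdf N \<and> arithmetic_span N h) \<and>
     (\<lambda>n::nat. lattice_mass h H (int (n + 1)) / lattice_mass h H (int n)) \<longlonglongrightarrow> 1 \<and>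
     (\<lambda>n::nat. lattice_mass h (cdf_convolution H H) (int n) / lattice_mass h H (int n)) \<longlonglongrightarrow> 2"

text \<open>The functions of the next class live on the positive half-line; as total functions they are
  unconstrained elsewhere.\<close>

definition Q_class :: "real \<Rightarrow> real \<Rightarrow> (real \<Rightarrow> real) set" where
  "Q_class \<kappa> h = {q. (\<forall>x>0. q x \<ge> 0) \<and>
     antimono_on {0<..} (\<lambda>x. x powr (- \<kappa>) * q x) \<and>
     (\<forall>x>0. q (x * exp h) = q x)}"

definition continuity_points :: "(real \<Rightarrow> real) \<Rightarrow> real set" where
  "continuity_points q = {x. x > 0 \<and> isCont q x}"

text \<open>\<open>X\<close> solves \<open>X = A X + B\<close> in distribution. Only the law of \<open>X\<close> matters, so \<open>X\<close> may live on
  a space of its own, and an independent copy of \<open>X\<close> is realised on the product space.\<close>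

definition perpetuity_solution ::
  "'a measure \<Rightarrow> ('a \<Rightarrow> real) \<Rightarrow> ('a \<Rightarrow> real) \<Rightarrow> 'b measure \<Rightarrow> ('b \<Rightarrow> real) \<Rightarrow> bool" where
  "perpetuity_solution M A B N X \<longleftrightarrow>
     X \<in> borel_measurable N \<and>
     distr N borel X = distr (M \<Otimes>\<^sub>M N) borel (\<lambda>(\<omega>, \<eta>). A \<omega> * X \<eta> + B \<omega>)"

end

theory Submission
  imports Defs
begin

text \<open>Write \<open>T\<^sub>n(x) = p\<^sub>n\<inverse> e\<^sup>\<kappa>\<^sup>n\<^sup>h P(X > x e\<^sup>n\<^sup>h)\<close>. For a Lipschitz ramp \<open>\<Phi>\<close> that vanishes
  below \<open>a\<close> and is constant above \<open>b\<close>, the numbers \<open>g\<^sub>n = e\<^sup>\<kappa>\<^sup>n\<^sup>h E \<Phi>(X e\<^sup>-\<^sup>n\<^sup>h)\<close> satisfy the defective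
  renewal equation \<open>g = \<psi> + \<theta> p * g\<close> on the integers, since \<open>A\<close> is 0 or in the lattice
  \<open>e\<^sup>k\<^sup>h\<close>. Here \<open>\<psi>\<^sub>n\<close> measures the effect of \<open>B\<close>; it decays exponentially, whereas subexponential masses do
  not. Subexponentiality then gives \<open>g\<^sub>n / p\<^sub>n \<longlongrightarrow> \<theta> G / (1 - \<theta>)\<close> with \<open>G = \<Sum> g\<^sub>j\<close>: in \<open>\<Sum> p\<^sub>n\<^sub>-\<^sub>j g\<^sub>j\<close> the indices
  \<open>j < m\<close> contribute \<open>p\<^sub>n \<Sum> g\<^sub>j\<close> by dominated convergence, and the indices \<open>j \<ge> m\<close> reproduce the quotient
  \<open>g / p\<close> with total weight close to 1, so that \<open>\<theta> < 1\<close> makes the deviation from the limit contract.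
  The limits for all ramps squeeze \<open>T\<^sub>n\<close> at the continuity points of its upper limit, and
  \<open>p\<^sub>n\<^sub>+\<^sub>1 \<sim> p\<^sub>n\<close> makes \<open>x\<^sup>\<kappa> limsup T\<^sub>n(x)\<close> multiplicatively periodic. Positivity is the principle of one
  big jump: \<open>X\<close> is large if \<open>A = e\<^sup>(\<^sup>n\<^sup>+\<^sup>j\<^sup>)\<^sup>h\<close>, \<open>B\<close> is moderate and \<open>X\<close> on the right-hand side is not
  close to 0. The left tail is the right tail of \<open>-X\<close>, which solves the equation for \<open>(A, -B)\<close>.\<close>

subsection \<open>Defective renewal equations with subexponential masses\<close>

lemma filterlim_add_int: "filterlim (\<lambda>m::int. m + j) at_top at_top"
  unfolding filterlim_at_top eventually_at_top_linorder
proof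
  fix Z show "\<exists>N. \<forall>n\<ge>N. Z \<le> n + j" by (rule exI[of _ "Z - j"]) auto
qed

text \<open>Series over the integers are Bochner integrals for the counting measure, which makes
  dominated convergence available. \<open>low m\<close> collects all indices below \<open>m\<close>,
  the negative ones included.\<close>

definition low :: "int \<Rightarrow> (int \<Rightarrow> real) \<Rightarrow> real" where
  "low m f = (\<integral>j. indicator {..<m} j * f j \<partial>count_space UNIV)"

definition high :: "int \<Rightarrow> (int \<Rightarrow> real) \<Rightarrow> real" where
  "high m f = (\<integral>j. indicator {m..} j * f j \<partial>count_space UNIV)"

lemma integrable_indicator_count:
  fixes f :: "int \<Rightarrow> real"
  assumes "integrable (count_space UNIV) f"
  shows "integrable (count_space UNIV) (\<lambda>j. indicator S j * f j)"
  by (rule Bochner_Integration.integrable_bound[OF assms]) (auto simp: indicator_def)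

lemma low_add_high:
  assumes "integrable (count_space UNIV) f"
  shows "(\<integral>j. f j \<partial>count_space UNIV) = low m f + high m f"
proof -
  have "low m f + high m f =
      (\<integral>j. indicator {..<m} j * f j + indicator {m..} j * f j \<partial>count_space UNIV)"
    unfolding low_def high_def
    by (rule Bochner_Integration.integral_add[symmetric]) (intro integrable_indicator_count assms)+
  also have "(\<lambda>j. indicator {..<m} j * f j + indicator {m..} j * f j) = f"
    by (auto simp: indicator_def)
  finally show ?thesis by simp
qed

lemma low_tendsto:
  assumes "integrable (count_space UNIV) f"
  shows "(\<lambda>m. low (int m) f) \<longlonglongrightarrow> (\<integral>j. f j \<partial>count_space UNIV)"
  unfolding low_def
proof (rule integral_dominated_convergence[where w = "\<lambda>j. \<bar>f j\<bar>"])
  show "AE j in count_space UNIV. (\<lambda>m. indicator {..<int m} j * f j) \<longlonglongrightarrow> f j"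
  proof (rule AE_I2, rule tendsto_eventually)
    fix j
    show "\<forall>\<^sub>F m in sequentially. indicator {..<int m} j * f j = f j"
      using eventually_gt_at_top[of "nat j"] by eventually_elim (auto simp: indicator_def)
  qed
qed (auto simp: assms indicator_def)

text \<open>Every eventual bound \<open>E\<close> improves to \<theta> E + \<epsilon>. Iteration
  from \<open>E0\<close> leaves only the accumulated errors, and these stay small because \<theta> <
  1.\<close>

lemma tendsto_zero_contraction:
  fixes e :: "nat \<Rightarrow> real"
  assumes th: "0 < \<theta>" "\<theta> < 1" and E0: "E0 \<ge> 0" "\<forall>\<^sub>F n in sequentially. \<bar>e n\<bar> \<le> E0"
    and step: "\<And>E \<epsilon>. E \<ge> 0 \<Longrightarrow> \<epsilon> > 0 \<Longrightarrow> \<forall>\<^sub>F n in sequentially. \<bar>e n\<bar> \<le> E \<Longrightarrow>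
       \<forall>\<^sub>F n in sequentially. \<bar>e n\<bar> \<le> \<theta> * E + \<epsilon>"
  shows "e \<longlonglongrightarrow> 0"
proof (rule tendstoI)
  fix \<epsilon> :: real assume \<epsilon>: "\<epsilon> > 0"
  have iter: "\<forall>\<^sub>F n in sequentially. \<bar>e n\<bar> \<le> \<theta> ^ i * E0 + \<epsilon> / 2" for i
  proof (induction i)
    case 0
    show ?case using E0(2) by eventually_elim (use \<epsilon> in auto)
  next
    case (Suc i)
    \<comment> \<open>With the error (1 - \<theta>) \<epsilon> / 2 the number \<epsilon> / 2 is a
      fixed point of the step, so that only the multiple of \<open>E0\<close> shrinks.\<close>
    have "\<forall>\<^sub>F n in sequentially. \<bar>e n\<bar> \<le> \<theta> * (\<theta> ^ i * E0 + \<epsilon> / 2) + (1 - \<theta>) * (\<epsilon> / 2)"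
      using Suc \<epsilon> th E0(1) by (intro step) auto
    also have "\<theta> * (\<theta> ^ i * E0 + \<epsilon> / 2) + (1 - \<theta>) * (\<epsilon> / 2) = \<theta> ^ Suc i * E0 + \<epsilon> / 2"
      by (simp add: field_simps)
    finally show ?case .
  qed
  have "(\<lambda>i. \<theta> ^ i * E0 + \<epsilon> / 2) \<longlonglongrightarrow> 0 * E0 + \<epsilon> / 2"
    using th by (intro tendsto_intros LIMSEQ_power_zero) auto
  hence "\<forall>\<^sub>F i in sequentially. \<theta> ^ i * E0 + \<epsilon> / 2 < \<epsilon>"
    by (rule order_tendstoD) (use \<epsilon> in auto)
  then obtain i where i: "\<theta> ^ i * E0 + \<epsilon> / 2 < \<epsilon>" unfolding eventually_sequentially by blast
  show "\<forall>\<^sub>F n in sequentially. dist (e n) 0 < \<epsilon>"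
    using iter[of i] by eventually_elim (use i in auto)
qed

section \<open>Ratios and slow decay of subexponential masses\<close>

locale subexponential_sequence =
  fixes p :: "int \<Rightarrow> real" and C :: real
  assumes p_nonneg: "p k \<ge> 0"
    and p_integrable: "integrable (count_space UNIV) p"
    and p_total: "(\<integral>j. p j \<partial>count_space UNIV) = 1"
    and p_ratio: "(\<lambda>n. p (int (n + 1)) / p (int n)) \<longlonglongrightarrow> 1"
    and p_convolution:
      "(\<lambda>n. (\<integral>j. p (int n - j) * p j \<partial>count_space UNIV) / p (int n)) \<longlonglongrightarrow> 2"
    and p_dominated: "\<forall>\<^sub>F n in sequentially. \<forall>k\<ge>n. p (int k) \<le> C * p (int n)"
begin

text \<open>On the filter \<open>at_top\<close> of the integers, shifts in both directions are
  instances of \<open>filterlim_add_int\<close>; within the natural numbers a negative shift would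
  need truncation.\<close>

lemma p_ratio_int: "((\<lambda>m::int. p (m + 1) / p m) \<longlongrightarrow> 1) at_top"
proof -
  have "filterlim nat sequentially at_top"
    unfolding filterlim_at_top eventually_at_top_linorder by (metis nat_mono nat_int)
  from filterlim_compose[OF p_ratio this]
  have *: "((\<lambda>m. p (int (nat m + 1)) / p (int (nat m))) \<longlongrightarrow> 1) at_top" .
  show ?thesis
    by (rule Lim_transform_eventually[OF *])
       (auto simp: eventually_at_top_linorder add.commute intro!: exI[of _ 0])
qed

text \<open>A ratio tending to 1 is eventually positive, and division by 0 yields 0, so the
  denominator is eventually nonzero.\<close>

lemma p_pos_int: "\<forall>\<^sub>F m::int in at_top. p m > 0"
proof -
  have "\<forall>\<^sub>F m::int in at_top. p (m + 1) / p m > 0"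
    using order_tendstoD(1)[OF p_ratio_int, of 0] by simp
  thus ?thesis
    by eventually_elim (metis p_nonneg division_ring_divide_zero less_eq_real_def less_irrefl)
qed

text \<open>The quotient telescopes: each step upwards multiplies by one successive ratio, each step
  downwards divides by one.\<close>

lemma p_shift_int: "((\<lambda>m::int. p (m + j) / p m) \<longlongrightarrow> 1) at_top"
proof (induction j rule: int_induct[of _ 0])
  case base
  show ?case
    by (rule Lim_transform_eventually[OF tendsto_const]) (use p_pos_int in eventually_elim, auto)
next
  case (step1 i)
  have "((\<lambda>m. (p (m + i + 1) / p (m + i)) * (p (m + i) / p m)) \<longlongrightarrow> 1 * 1) at_top"
    by (intro tendsto_mult step1 filterlim_compose[OF p_ratio_int filterlim_add_int])
  moreover have "\<forall>\<^sub>F m::int in at_top. p (m + i) > 0"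
    using p_pos_int filterlim_add_int[of i] unfolding filterlim_iff by blast
  hence "\<forall>\<^sub>F m::int in at_top.
      (p (m + i + 1) / p (m + i)) * (p (m + i) / p m) = p (m + (i + 1)) / p m"
    by eventually_elim (simp add: add.assoc)
  ultimately show ?case
    using Lim_transform_eventually by fastforce
next
  case (step2 i)
  have "((\<lambda>m. (p (m + i) / p m) / (p (m + (i - 1) + 1) / p (m + (i - 1)))) \<longlongrightarrow> 1 / 1) at_top"
    by (intro tendsto_divide step2 filterlim_compose[OF p_ratio_int filterlim_add_int]) auto
  moreover have "\<forall>\<^sub>F m::int in at_top. p (m + i) > 0"
    using p_pos_int filterlim_add_int[of i] unfolding filterlim_iff by blast
  hence "\<forall>\<^sub>F m::int in at_top.
     (p (m + i) / p m) / (p (m + (i - 1) + 1) / p (m + (i - 1))) = p (m + (i - 1)) / p m"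
    by eventually_elim (simp add: algebra_simps)
  ultimately show ?case
    using Lim_transform_eventually by fastforce
qed

lemma p_pos: "\<forall>\<^sub>F n in sequentially. p (int n) > 0"
  using p_pos_int filterlim_int_sequentially unfolding filterlim_iff by blast

lemma p_shift: "(\<lambda>n. p (int n + j) / p (int n)) \<longlonglongrightarrow> 1"
  by (rule filterlim_compose[OF p_shift_int filterlim_int_sequentially])

text \<open>Successive terms have quotients tending to \<open>r < 1\<close>, so their series
  converges by the ratio test. Masses with ratios tending to 1 decay more slowly than every
  exponential.\<close>

lemma geometric_negligible:
  assumes "0 < r" "r < 1"
  shows "(\<lambda>n. r ^ n / p (int n)) \<longlonglongrightarrow> 0"
proof -
  define s where "s = (1 + r) / 2"
  have s: "r < s" "s < 1" using assms by (auto simp: s_def)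
  have "(\<lambda>n. r / (p (int (n + 1)) / p (int n))) \<longlonglongrightarrow> r / 1"
    by (intro tendsto_divide tendsto_const p_ratio) simp
  hence "\<forall>\<^sub>F n in sequentially. r / (p (int (n + 1)) / p (int n)) < s"
    using s order_tendstoD(2) by fastforce
  moreover have "\<forall>\<^sub>F n in sequentially. p (int (Suc n)) > 0"
    using p_pos by (subst eventually_sequentially_Suc)
  ultimately have "\<forall>\<^sub>F n in sequentially.
      norm (r ^ Suc n / p (int (Suc n))) \<le> s * norm (r ^ n / p (int n))"
    using p_pos
  proof eventually_elim
    case (elim n)
    have "norm (r ^ Suc n / p (int (Suc n))) =
        r / (p (int (n + 1)) / p (int n)) * norm (r ^ n / p (int n))"
      using elim assms by (simp add: field_simps)
    also have "\<dots> \<le> s * norm (r ^ n / p (int n))"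
      using elim by (intro mult_right_mono) auto
    finally show ?case .
  qed
  then obtain n0 where "\<And>n. n \<ge> n0 \<Longrightarrow>
      norm (r ^ Suc n / p (int (Suc n))) \<le> s * norm (r ^ n / p (int n))"
    unfolding eventually_sequentially by blast
  hence "summable (\<lambda>n. r ^ n / p (int n))" by (rule summable_ratio_test[OF s(2)])
  thus ?thesis by (rule summable_LIMSEQ_zero)
qed

section \<open>Convolutions with the masses, cut at a fixed index\<close>

lemma integrable_reflect:
  assumes "\<And>j. \<bar>f j\<bar> \<le> S"
  shows "integrable (count_space UNIV) (\<lambda>j. p (n - j) * f j)"
proof -
  have b: "bij_betw (\<lambda>j. n - j) UNIV (UNIV :: int set)"
    by (rule bij_betwI[where g = "\<lambda>j. n - j"]) auto
  have "integrable (count_space UNIV) (\<lambda>j. p (n - j))"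
    using integrable_bij_count_space[OF b, of p] p_integrable by simp
  hence "integrable (count_space UNIV) (\<lambda>j. p (n - j) * S)" by simp
  thus ?thesis
    by (rule Bochner_Integration.integrable_bound)
       (auto simp: abs_mult p_nonneg intro!: AE_I2 mult_left_mono order_trans[OF assms])
qed

lemma integral_reflect: "(\<integral>j. p (n - j) \<partial>count_space UNIV) = 1"
proof -
  have b: "bij_betw (\<lambda>j. n - j) UNIV (UNIV :: int set)"
    by (rule bij_betwI[where g = "\<lambda>j. n - j"]) auto
  show ?thesis
    using integral_bij_count_space[OF b, of p] p_total by simp
qed

lemma p_le_1: "p k \<le> 1"
proof -
  have "(\<integral>j. indicator {k} j * p k \<partial>count_space UNIV) \<le> (\<integral>j. p j \<partial>count_space UNIV)"
  proof (rule integral_mono)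
    show "integrable (count_space UNIV) (\<lambda>j. indicator {k} j * p k)"
      by (rule Bochner_Integration.integrable_bound[OF p_integrable])
         (auto simp: indicator_def p_nonneg)
  qed (auto simp: p_integrable indicator_def p_nonneg)
  thus ?thesis using p_total by (simp add: lebesgue_integral_count_space_finite_support indicator_def)
qed

text \<open>Dominated convergence: for fixed \<open>j\<close> the weight
  \<open>p (n - j) / p n\<close> tends to 1. The majorant comes from \<open>p_dominated\<close>:
  \<open>j < m\<close> puts \<open>n - j\<close> beyond \<open>n - m\<close>, so the numerator is at
  most \<open>C * p (n - m)\<close>, and \<open>p (n - m)\<close> is eventually below
  \<open>2 * p n\<close>.\<close>

lemma low_convolution:
  assumes "integrable (count_space UNIV) (\<lambda>j. indicator {..<m} j * b j)"
  shows "(\<lambda>n. low m (\<lambda>j. p (int n - j) * b j) / p (int n)) \<longlonglongrightarrow> low m b"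
proof -
  have "(\<lambda>n. p (int n + (- m)) / p (int n)) \<longlonglongrightarrow> 1" by (rule p_shift)
  hence "\<forall>\<^sub>F n in sequentially. p (int n + (- m)) / p (int n) < 2"
    by (rule order_tendstoD) simp
  moreover have "filterlim (\<lambda>n. nat (int n + (- m))) sequentially sequentially"
    unfolding filterlim_at_top
  proof
    fix Z :: nat
    show "\<forall>\<^sub>F n in sequentially. Z \<le> nat (int n + (- m))"
      using eventually_ge_at_top[of "Z + nat (\<bar>m\<bar>)"] by eventually_elim auto
  qed
  with p_dominated have "\<forall>\<^sub>F n in sequentially.
     \<forall>k\<ge>nat (int n + (- m)). p (int k) \<le> C * p (int (nat (int n + (- m))))"
    unfolding filterlim_iff by blast
  ultimately have "\<forall>\<^sub>F n in sequentially. \<forall>j<m. \<bar>p (int n - j) / p (int n)\<bar> \<le> 2 * \<bar>C\<bar>"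
    using p_pos eventually_ge_at_top[of "nat (\<bar>m\<bar>)"]
  proof eventually_elim
    case (elim n)
    show ?case
    proof (intro allI impI)
      fix j assume j: "j < m"
      have e: "int (nat (int n - j)) = int n - j" "int (nat (int n + - m)) = int n - m"
        using elim j by auto
      have "p (int (nat (int n - j))) \<le> C * p (int (nat (int n + - m)))"
        by (rule elim(2)[rule_format]) (use j in auto)
      hence "p (int n - j) \<le> C * p (int n - m)" unfolding e .
      also have "\<dots> \<le> \<bar>C\<bar> * p (int n - m)"
        by (intro mult_right_mono p_nonneg) auto
      also have "\<dots> \<le> \<bar>C\<bar> * (2 * p (int n))"
        using elim(1,3) by (intro mult_left_mono) (auto simp: field_simps)
      finally show "\<bar>p (int n - j) / p (int n)\<bar> \<le> 2 * \<bar>C\<bar>"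
        using elim(3) p_nonneg[of "int n - j"] by (simp add: field_simps)
    qed
  qed
  then obtain n1 where n1: "\<And>n j. n \<ge> n1 \<Longrightarrow> j < m \<Longrightarrow> \<bar>p (int n - j) / p (int n)\<bar> \<le> 2 * \<bar>C\<bar>"
    unfolding eventually_sequentially by blast
  \<comment> \<open>The majorant holds from \<open>n1\<close> on, whereas dominated convergence asks
    for it at every \<open>n\<close>. The sequence is therefore shifted by \<open>n1\<close>, which
    \<open>LIMSEQ_offset\<close> undoes.\<close>
  have "(\<lambda>n. \<integral>j. indicator {..<m} j * (p (int (n + n1) - j) / p (int (n + n1)) * b j)
        \<partial>count_space UNIV) \<longlonglongrightarrow> (\<integral>j. indicator {..<m} j * b j \<partial>count_space UNIV)"
  proof (rule integral_dominated_convergence[where w = "\<lambda>j. 2 * \<bar>C\<bar> * \<bar>indicator {..<m} j * b j\<bar>"])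
    show "AE j in count_space UNIV.
      (\<lambda>n. indicator {..<m} j * (p (int (n + n1) - j) / p (int (n + n1)) * b j)) \<longlonglongrightarrow>
      indicator {..<m} j * b j"
    proof (rule AE_I2)
      fix j
      have "(\<lambda>n. p (int n + (- j)) / p (int n)) \<longlonglongrightarrow> 1" by (rule p_shift)
      from LIMSEQ_ignore_initial_segment[OF this, of n1]
      have "(\<lambda>n. p (int (n + n1) - j) / p (int (n + n1))) \<longlonglongrightarrow> 1" by simp
      hence "(\<lambda>n. indicator {..<m} j * (p (int (n + n1) - j) / p (int (n + n1)) * b j)) \<longlonglongrightarrow>
         indicator {..<m} j * (1 * b j)" by (intro tendsto_intros)
      thus "(\<lambda>n. indicator {..<m} j * (p (int (n + n1) - j) / p (int (n + n1)) * b j)) \<longlonglongrightarrow>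
         indicator {..<m} j * b j" by simp
    qed
    fix n
    show "AE j in count_space UNIV.
      norm (indicator {..<m} j * (p (int (n + n1) - j) / p (int (n + n1)) * b j))
        \<le> 2 * \<bar>C\<bar> * \<bar>indicator {..<m} j * b j\<bar>"
    proof (rule AE_I2)
      fix j
      show "norm (indicator {..<m} j * (p (int (n + n1) - j) / p (int (n + n1)) * b j))
        \<le> 2 * \<bar>C\<bar> * \<bar>indicator {..<m} j * b j\<bar>"
      proof (cases "j < m")
        case True
        have "\<bar>p (int (n + n1) - j) / p (int (n + n1))\<bar> * \<bar>b j\<bar> \<le> 2 * \<bar>C\<bar> * \<bar>b j\<bar>"
          by (rule mult_right_mono[OF n1]) (use True in auto)
        thus ?thesis using True by (simp add: indicator_def abs_mult)
      qed simp
    qed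
  qed (use assms in auto)
  hence "(\<lambda>n. low m (\<lambda>j. p (int (n + n1) - j) * b j) / p (int (n + n1))) \<longlonglongrightarrow> low m b"
    unfolding low_def by (simp flip: integral_divide_zero add: mult.assoc)
  thus ?thesis by (rule LIMSEQ_offset)
qed

text \<open>Of the limit 2 of the self-convolution, the indices below \<open>m\<close> take
  \<open>low m p\<close> by \<open>low_convolution\<close>. The remainder approaches 1 as
  \<open>m\<close> grows, which is what makes the renewal equation contract.\<close>

lemma high_convolution:
  "(\<lambda>n. high m (\<lambda>j. p (int n - j) * p j) / p (int n)) \<longlonglongrightarrow> 2 - low m p"
proof -
  have "(\<integral>j. p (int n - j) * p j \<partial>count_space UNIV) - low m (\<lambda>j. p (int n - j) * p j)
     = high m (\<lambda>j. p (int n - j) * p j)" for n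
    by (subst low_add_high[where m = m]) (auto intro!: integrable_reflect[where S = 1] simp: p_le_1 p_nonneg)
  moreover have "(\<lambda>n. (\<integral>j. p (int n - j) * p j \<partial>count_space UNIV) / p (int n)
      - low m (\<lambda>j. p (int n - j) * p j) / p (int n)) \<longlonglongrightarrow> 2 - low m p"
    by (intro tendsto_diff p_convolution low_convolution integrable_indicator_count p_integrable)
  ultimately show ?thesis by (simp flip: diff_divide_distrib)
qed

lemma high_mono:
  assumes "\<And>j. \<bar>f j\<bar> \<le> S" "\<And>j. \<bar>f' j\<bar> \<le> S'" "\<And>j. j \<ge> m \<Longrightarrow> f j \<le> f' j"
  shows "high m (\<lambda>j. p (n - j) * f j) \<le> high m (\<lambda>j. p (n - j) * f' j)"
  unfolding high_def
  by (rule integral_mono[OF integrable_indicator_count[OF integrable_reflect[where f = f, OF assms(1)]]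
        integrable_indicator_count[OF integrable_reflect[where f = f', OF assms(2)]]])
     (auto intro!: mult_left_mono assms(3) p_nonneg simp: indicator_def)

lemma high_linear:
  assumes "\<And>j. \<bar>f j\<bar> \<le> S"
  shows "high m (\<lambda>j. p (n - j) * (c * f j + d)) =
     c * high m (\<lambda>j. p (n - j) * f j) + d * high m (\<lambda>j. p (n - j))"
proof -
  have i: "integrable (count_space UNIV) (\<lambda>j. indicator {m..} j * (p (n - j) * f j))"
    "integrable (count_space UNIV) (\<lambda>j. indicator {m..} j * p (n - j))"
    using integrable_indicator_count[OF integrable_reflect[where f = f, OF assms]]
      integrable_indicator_count[OF integrable_reflect[of "\<lambda>_. 1" 1]] by auto
  have "high m (\<lambda>j. p (n - j) * (c * f j + d)) =
    (\<integral>j. c * (indicator {m..} j * (p (n - j) * f j)) + d * (indicator {m..} j * p (n - j))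
       \<partial>count_space UNIV)"
    unfolding high_def by (rule Bochner_Integration.integral_cong) (auto simp: algebra_simps)
  thus ?thesis unfolding high_def using i by simp
qed

lemma high_reflect_le_1: "high m (\<lambda>j. p (n - j)) \<le> 1"
proof -
  have "integrable (count_space UNIV) (\<lambda>j. p (n - j))"
    using integrable_reflect[of "\<lambda>_. 1" 1] by simp
  thus ?thesis unfolding high_def integral_reflect[of n, symmetric]
    by (intro integral_mono integrable_indicator_count) (auto simp: indicator_def p_nonneg)
qed

text \<open>For large \<open>m\<close> the indices \<open>j \<ge> m\<close> of the convolution carry a total weight below 1 relative to \<open>p\<close>,
  so that the trivial bound \<open>g \<le> a p + S\<close> improves itself to \<open>g \<le> a p + \<theta>\<^sup>i S\<close> for every \<open>i\<close>.\<close>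

lemma renewal_bounded:
  assumes th: "0 < \<theta>" "\<theta> < 1"
    and g: "\<And>j. 0 \<le> g j" "\<And>j. g j \<le> S"
    and g_low: "\<And>m. integrable (count_space UNIV) (\<lambda>j. indicator {..<m} j * g j)"
    and \<psi>: "(\<lambda>n. \<psi> n / p (int n)) \<longlonglongrightarrow> 0"
    and eq: "\<And>n. g (int n) = \<psi> n + \<theta> * (\<integral>j. p (int n - j) * g j \<partial>count_space UNIV)"
  shows "\<exists>a m. a \<ge> 0 \<and> (\<forall>n\<ge>m. g (int n) \<le> a * p (int n))"
proof -
  have S: "0 \<le> S" using g[of 0] by simp
  have gS: "\<bar>g j\<bar> \<le> S" for j using g[of j] by simp
  \<comment> \<open>The limiting weight of the indices from \<open>m\<close> on approaches \<theta>
    (2 - 1) < 1, so some \<open>m\<close> brings it below 1. Taking \<open>m \<ge> n0\<close> keeps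
    the masses positive from \<open>m\<close> on.\<close>
  have "(\<lambda>m. \<theta> * (2 - low (int m) p)) \<longlonglongrightarrow> \<theta> * (2 - 1)"
    using low_tendsto[OF p_integrable] p_total by (intro tendsto_intros) auto
  hence "\<forall>\<^sub>F m in sequentially. \<theta> * (2 - low (int m) p) < 1"
    using th order_tendstoD(2) by fastforce
  moreover obtain n0 where n0: "\<And>n. n \<ge> n0 \<Longrightarrow> p (int n) > 0"
    using p_pos unfolding eventually_sequentially by blast
  ultimately obtain m where m: "\<theta> * (2 - low (int m) p) < 1" "m \<ge> n0"
    unfolding eventually_sequentially by (meson nat_le_linear order.trans)
  obtain r where r: "\<theta> * (2 - low (int m) p) < r" "r < 1" using dense[OF m(1)] by blast
  define G where "G = \<theta> * low (int m) g"
  have "(\<lambda>n. \<theta> * (low (int m) (\<lambda>j. p (int n - j) * g j) / p (int n))) \<longlonglongrightarrow> G"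
    unfolding G_def by (intro tendsto_mult tendsto_const low_convolution g_low)
  hence e1: "\<forall>\<^sub>F n in sequentially.
      \<theta> * (low (int m) (\<lambda>j. p (int n - j) * g j) / p (int n)) < G + 1"
    by (rule order_tendstoD) simp
  have "(\<lambda>n. \<theta> * (high (int m) (\<lambda>j. p (int n - j) * p j) / p (int n))) \<longlonglongrightarrow>
      \<theta> * (2 - low (int m) p)"
    by (intro tendsto_mult tendsto_const high_convolution)
  hence e2: "\<forall>\<^sub>F n in sequentially.
      \<theta> * (high (int m) (\<lambda>j. p (int n - j) * p j) / p (int n)) < r"
    by (rule order_tendstoD) (rule r)
  have e3: "\<forall>\<^sub>F n in sequentially. \<psi> n / p (int n) < 1"
    using \<psi> by (rule order_tendstoD) simp
  obtain n1 where n1: "\<And>n. n \<ge> n1 \<Longrightarrow>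
     \<theta> * (low (int m) (\<lambda>j. p (int n - j) * g j) / p (int n)) < G + 1"
     "\<And>n. n \<ge> n1 \<Longrightarrow> \<theta> * (high (int m) (\<lambda>j. p (int n - j) * p j) / p (int n)) < r"
     "\<And>n. n \<ge> n1 \<Longrightarrow> \<psi> n / p (int n) < 1" "\<And>n. n \<ge> n1 \<Longrightarrow> p (int n) > 0"
    using eventually_conj[OF e1 eventually_conj[OF e2 eventually_conj[OF e3 p_pos]]]
    unfolding eventually_sequentially by blast
  have G: "G \<ge> 0" unfolding G_def low_def using th g
    by (intro mult_nonneg_nonneg Bochner_Integration.integral_nonneg) auto
  \<comment> \<open>The sum settles the \<open>n\<close> with \<open>m \<le> n < n1\<close>, where
    only \<open>g \<le> S\<close> is known. The fraction ensures
    \<open>G + 2 + a * r \<le> a\<close>: \<open>G + 1\<close> bounds the lower block, 1 bounds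
    \<psi> relative to \<open>p\<close>, and \<open>r\<close> is the weight of the upper
    block.\<close>
  define a where "a = (\<Sum>n<n1. S / p (int n)) + (G + 2) / (1 - r)"
  have a1: "a \<ge> (G + 2) / (1 - r)" "a \<ge> 0"
    unfolding a_def using S p_nonneg r G by (auto intro!: sum_nonneg add_nonneg_nonneg)
  have claim: "g (int n) \<le> a * p (int n) + \<theta> ^ i * S" if "n \<ge> m" for i n
    using that
  proof (induction i arbitrary: n)
    case 0
    show ?case using g(2)[of "int n"] a1 p_nonneg[of "int n"] by (simp add: add_increasing)
  next
    case (Suc i)
    have pp: "p (int n) > 0" using n0 m(2) Suc.prems by auto
    show ?case
    proof (cases "n < n1")
      case True
      have "g (int n) \<le> S" by (rule g)
      also have "S = S / p (int n) * p (int n)" using pp by simp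
      also have "\<dots> \<le> a * p (int n)"
      proof (rule mult_right_mono)
        have "S / p (int n) \<le> (\<Sum>n<n1. S / p (int n))"
          by (rule member_le_sum) (use True S p_nonneg in auto)
        thus "S / p (int n) \<le> a" unfolding a_def using r G by (simp add: add_increasing2)
      qed (rule p_nonneg)
      finally show ?thesis using th S by (simp add: add_increasing2)
    next
      case False
      hence n: "n \<ge> n1" by simp
      \<comment> \<open>The induction hypothesis applies to all indices \<open>j \<ge> m\<close>.
        Its constant part passes through the convolution with weight at most 1 and then gains a
        factor \<theta>.\<close>
      have "high (int m) (\<lambda>j. p (int n - j) * g j) \<le>
         high (int m) (\<lambda>j. p (int n - j) * (a * p j + \<theta> ^ i * S))"
      proof (rule high_mono[OF gS])
        show "\<bar>a * p j + \<theta> ^ i * S\<bar> \<le> a * 1 + \<theta> ^ i * S" for j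
        proof -
          have "a * p j \<le> a * 1" by (intro mult_left_mono p_le_1 a1)
          moreover have "0 \<le> a * p j" using a1 p_nonneg by simp
          ultimately show ?thesis using th S by (simp add: abs_of_nonneg)
        qed
        show "g j \<le> a * p j + \<theta> ^ i * S" if "j \<ge> int m" for j
          using Suc.IH[of "nat j"] that by simp
      qed
      also have "\<dots> = a * high (int m) (\<lambda>j. p (int n - j) * p j)
           + \<theta> ^ i * S * high (int m) (\<lambda>j. p (int n - j))"
        by (rule high_linear[where S = 1]) (simp add: p_nonneg p_le_1)
      also have "\<dots> \<le> a * high (int m) (\<lambda>j. p (int n - j) * p j) + \<theta> ^ i * S * 1"
        using th S by (intro add_left_mono mult_left_mono high_reflect_le_1) auto
      finally have h: "\<theta> * high (int m) (\<lambda>j. p (int n - j) * g j) \<le>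
         \<theta> * (a * high (int m) (\<lambda>j. p (int n - j) * p j) + \<theta> ^ i * S)"
        using th by (simp add: mult_left_mono)
      have "\<theta> * high (int m) (\<lambda>j. p (int n - j) * p j) \<le> r * p (int n)"
        using n1(2)[OF n] pp by (simp add: field_simps)
      hence "a * (\<theta> * high (int m) (\<lambda>j. p (int n - j) * p j)) \<le> a * (r * p (int n))"
        by (intro mult_left_mono a1)
      with h have h': "\<theta> * high (int m) (\<lambda>j. p (int n - j) * g j) \<le>
          a * r * p (int n) + \<theta> ^ Suc i * S" by (simp add: algebra_simps)
      have l: "\<theta> * low (int m) (\<lambda>j. p (int n - j) * g j) \<le> (G + 1) * p (int n)"
        using n1(1)[OF n] pp by (simp add: field_simps)
      have ps: "\<psi> n \<le> p (int n)" using n1(3)[OF n] pp by (simp add: field_simps)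
      have "g (int n) = \<psi> n + \<theta> * low (int m) (\<lambda>j. p (int n - j) * g j)
          + \<theta> * high (int m) (\<lambda>j. p (int n - j) * g j)"
        unfolding eq
        by (subst low_add_high[where m = "int m", OF integrable_reflect[where f = g, OF gS]])
           (simp add: algebra_simps)
      also have "\<dots> \<le> (G + 2 + a * r) * p (int n) + \<theta> ^ Suc i * S"
        using h' l ps by (simp add: algebra_simps)
      also have "G + 2 \<le> a * (1 - r)" using a1(1) r by (simp add: field_simps)
      hence "(G + 2 + a * r) * p (int n) \<le> a * p (int n)"
        using pp by (intro mult_right_mono) (auto simp: algebra_simps)
      finally show ?thesis by simp
    qed
  qed
  have "g (int n) \<le> a * p (int n)" if "n \<ge> m" for n
  proof -
    have "(\<lambda>i. a * p (int n) + \<theta> ^ i * S) \<longlonglongrightarrow> a * p (int n) + 0 * S"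
      using th by (intro tendsto_intros LIMSEQ_power_zero) auto
    thus ?thesis using claim[OF that] by (intro LIMSEQ_le_const[of _ _ "g (int n)"]) auto
  qed
  thus ?thesis using a1 by blast
qed

text \<open>The bound by a multiple of \<open>p\<close> makes \<open>g\<close> summable. For large
  \<open>m\<close> the indices below \<open>m\<close> contribute about \<theta> G and the others
  \<theta> times the limit itself, which forces l = \<theta> G + \<theta> l; the deviation from this
  \<open>l\<close> contracts.\<close>

lemma renewal_limit:
  assumes th: "0 < \<theta>" "\<theta> < 1"
    and g: "\<And>j. 0 \<le> g j" "\<And>j. g j \<le> S"
    and g_low: "\<And>m. integrable (count_space UNIV) (\<lambda>j. indicator {..<m} j * g j)"
    and \<psi>: "(\<lambda>n. \<psi> n / p (int n)) \<longlonglongrightarrow> 0"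
    and eq: "\<And>n. g (int n) = \<psi> n + \<theta> * (\<integral>j. p (int n - j) * g j \<partial>count_space UNIV)"
  shows "\<exists>l. (\<lambda>n. g (int n) / p (int n)) \<longlonglongrightarrow> l"
proof -
  have gS: "\<bar>g j\<bar> \<le> S" for j using g[of j] by simp
  obtain a m0 where a: "a \<ge> 0" "\<And>n. n \<ge> m0 \<Longrightarrow> g (int n) \<le> a * p (int n)"
    using renewal_bounded[OF th g g_low \<psi> eq] by blast
  have gi: "integrable (count_space UNIV) g"
  proof (rule Bochner_Integration.integrable_bound)
    show "integrable (count_space UNIV) (\<lambda>j. indicator {..<int m0} j * g j + a * p j)"
      by (intro Bochner_Integration.integrable_add g_low integrable_mult_right p_integrable)
    show "AE j in count_space UNIV. norm (g j) \<le> norm (indicator {..<int m0} j * g j + a * p j)"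
    proof (rule AE_I2)
      fix j
      have "0 \<le> a * p j" using a p_nonneg by simp
      moreover have "g j \<le> a * p j" if "\<not> j < int m0" using a(2)[of "nat j"] that by simp
      ultimately show "norm (g j) \<le> norm (indicator {..<int m0} j * g j + a * p j)"
        using g(1)[of j] by (auto simp: indicator_def)
    qed
  qed simp
  define G where "G = (\<integral>j. g j \<partial>count_space UNIV)"
  have G: "G \<ge> 0" unfolding G_def using g by (intro Bochner_Integration.integral_nonneg) auto
  define l where "l = \<theta> * G / (1 - \<theta>)"
  have l: "l \<ge> 0" "\<theta> * G + \<theta> * l - l = 0" using th G by (auto simp: l_def field_simps)
  have "(\<lambda>n. g (int n) / p (int n) - l) \<longlonglongrightarrow> 0"
  proof (rule tendsto_zero_contraction[OF th])
    show "a + l \<ge> 0" using a l by simp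
    show "\<forall>\<^sub>F n in sequentially. \<bar>g (int n) / p (int n) - l\<bar> \<le> a + l"
      using p_pos eventually_ge_at_top[of m0]
    proof eventually_elim
      case (elim n)
      hence "g (int n) / p (int n) \<le> a" using a(2)[of n] by (simp add: field_simps)
      moreover have "g (int n) / p (int n) \<ge> 0" using g elim by auto
      ultimately show ?case using a l by linarith
    qed
  next
    fix E \<epsilon> :: real
    assume E: "E \<ge> 0" and \<epsilon>: "\<epsilon> > 0"
      and ev: "\<forall>\<^sub>F n in sequentially. \<bar>g (int n) / p (int n) - l\<bar> \<le> E"
    let ?P = "\<lambda>m. low (int m) p" and ?G = "\<lambda>m. low (int m) g"
    \<comment> \<open>This bound for the deviation arises when \<open>n\<close> tends to infinity
      with \<open>m\<close> fixed. As \<open>m\<close> grows, \<open>2 - ?P m\<close> tends to 1 and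
      the equation for \<open>l\<close> cancels the first summand, leaving \<theta> E.\<close>
    have "(\<lambda>m. \<bar>\<theta> * ?G m + \<theta> * l * (2 - ?P m) - l\<bar> + \<theta> * E * (2 - ?P m)) \<longlonglongrightarrow>
       \<bar>\<theta> * G + \<theta> * l * (2 - 1) - l\<bar> + \<theta> * E * (2 - 1)"
      unfolding G_def
      using low_tendsto[OF p_integrable] p_total low_tendsto[OF gi] by (intro tendsto_intros) auto
    hence "(\<lambda>m. \<bar>\<theta> * ?G m + \<theta> * l * (2 - ?P m) - l\<bar> + \<theta> * E * (2 - ?P m)) \<longlonglongrightarrow> \<theta> * E"
      using l(2) by simp
    hence "\<forall>\<^sub>F m in sequentially.
       \<bar>\<theta> * ?G m + \<theta> * l * (2 - ?P m) - l\<bar> + \<theta> * E * (2 - ?P m) < \<theta> * E + \<epsilon>"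
      by (rule order_tendstoD) (use \<epsilon> in auto)
    then obtain m1 where k1: "\<And>m. m \<ge> m1 \<Longrightarrow>
       \<bar>\<theta> * ?G m + \<theta> * l * (2 - ?P m) - l\<bar> + \<theta> * E * (2 - ?P m) < \<theta> * E + \<epsilon>"
      unfolding eventually_sequentially by blast
    obtain m2 where k2: "\<And>n. n \<ge> m2 \<Longrightarrow> \<bar>g (int n) / p (int n) - l\<bar> \<le> E \<and> p (int n) > 0"
      using eventually_conj[OF ev p_pos] unfolding eventually_sequentially by blast
    obtain m where
      m1: "\<bar>\<theta> * ?G m + \<theta> * l * (2 - ?P m) - l\<bar> + \<theta> * E * (2 - ?P m) < \<theta> * E + \<epsilon>"
      and m2: "\<And>n. n \<ge> m \<Longrightarrow> \<bar>g (int n) / p (int n) - l\<bar> \<le> E" "\<And>n. n \<ge> m \<Longrightarrow> p (int n) > 0"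
      using that[of "max m1 m2"] k1[of "max m1 m2"] k2 by auto
    define Lg where "Lg n = low (int m) (\<lambda>j. p (int n - j) * g j) / p (int n)" for n
    define Hp where "Hp n = high (int m) (\<lambda>j. p (int n - j) * p j) / p (int n)" for n
    have "(\<lambda>n. \<bar>\<psi> n / p (int n) + \<theta> * Lg n + \<theta> * l * Hp n - l\<bar> + \<theta> * E * Hp n) \<longlonglongrightarrow>
       \<bar>0 + \<theta> * ?G m + \<theta> * l * (2 - ?P m) - l\<bar> + \<theta> * E * (2 - ?P m)"
      unfolding Lg_def Hp_def
      by (intro tendsto_intros \<psi> low_convolution high_convolution g_low)
    hence "\<forall>\<^sub>F n in sequentially.
       \<bar>\<psi> n / p (int n) + \<theta> * Lg n + \<theta> * l * Hp n - l\<bar> + \<theta> * E * Hp n < \<theta> * E + \<epsilon>"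
      by (rule order_tendstoD) (use m1 in simp)
    thus "\<forall>\<^sub>F n in sequentially. \<bar>g (int n) / p (int n) - l\<bar> \<le> \<theta> * E + \<epsilon>"
      using eventually_ge_at_top[of m]
    proof eventually_elim
      case (elim n)
      have pp: "p (int n) > 0" using m2 elim by auto
      define Hg where "Hg = high (int m) (\<lambda>j. p (int n - j) * g j) / p (int n)"
      \<comment> \<open>From \<open>m\<close> on, the deviation bound encloses \<open>g\<close>
        between multiples of \<open>p\<close>, so that the upper block of \<open>g\<close> is
        controlled by the upper block of the self-convolution of \<open>p\<close>.\<close>
      have gj: "(l - E) * p j \<le> g j \<and> g j \<le> (l + E) * p j" if "j \<ge> int m" for j
      proof -
        have j: "int (nat j) = j" "nat j \<ge> m" using that by auto
        have pj: "p j > 0" using m2(2)[OF j(2)] j(1) by simp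
        have "l - E \<le> g j / p j \<and> g j / p j \<le> l + E"
          using m2(1)[OF j(2)] j(1) by (auto simp: abs_le_iff)
        thus ?thesis using pj by (simp add: field_simps)
      qed
      have bd: "\<bar>c * p j\<bar> \<le> \<bar>c\<bar>" for c j
        using p_nonneg[of j] p_le_1[of j] mult_left_le[of "p j" "\<bar>c\<bar>"] by (simp add: abs_mult)
      have "(l - E) * high (int m) (\<lambda>j. p (int n - j) * p j) \<le> high (int m) (\<lambda>j. p (int n - j) * g j)"
        using high_mono[of "\<lambda>j. (l - E) * p j" "\<bar>l - E\<bar>" g S "int m" "int n"] bd gS gj
          high_linear[of p 1 "int m" "int n" "l - E" 0] p_nonneg p_le_1 by simp
      moreover have "high (int m) (\<lambda>j. p (int n - j) * g j) \<le> (l + E) * high (int m) (\<lambda>j. p (int n - j) * p j)"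
        using high_mono[of g S "\<lambda>j. (l + E) * p j" "\<bar>l + E\<bar>" "int m" "int n"] bd gS gj
          high_linear[of p 1 "int m" "int n" "l + E" 0] p_nonneg p_le_1 by simp
      ultimately have H: "(l - E) * Hp n \<le> Hg" "Hg \<le> (l + E) * Hp n"
        unfolding Hp_def Hg_def using pp by (auto simp: divide_right_mono)
      have "g (int n) / p (int n) = \<psi> n / p (int n) + \<theta> * Lg n + \<theta> * Hg"
        unfolding eq Lg_def Hg_def
        by (subst low_add_high[where m = "int m", OF integrable_reflect[where f = g, OF gS]])
           (simp add: field_simps add_divide_distrib)
      moreover have "\<theta> * ((l - E) * Hp n) \<le> \<theta> * Hg" "\<theta> * Hg \<le> \<theta> * ((l + E) * Hp n)"
        using H th by (auto intro!: mult_left_mono)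
      hence "\<bar>\<theta> * Hg - \<theta> * l * Hp n\<bar> \<le> \<theta> * E * Hp n"
        by (simp add: algebra_simps abs_le_iff)
      ultimately have "\<bar>g (int n) / p (int n) - l\<bar> \<le>
          \<bar>\<psi> n / p (int n) + \<theta> * Lg n + \<theta> * l * Hp n - l\<bar> + \<theta> * E * Hp n"
        by linarith
      thus ?case using elim by linarith
    qed
  qed
  hence "(\<lambda>n. g (int n) / p (int n)) \<longlonglongrightarrow> l" by (simp add: Lim_null[of _ l])
  thus ?thesis by blast
qed

end

subsection \<open>The tilted lattice distribution\<close>

lemma lattice_mass_cdf:
  assumes "finite_borel_measure T"
  shows "lattice_mass h (cdf T) k = measure T {of_int k * h}"
proof -
  interpret finite_borel_measure T by fact
  have "Lim (at_left (of_int k * h)) (cdf T) = measure T {..<of_int k * h}"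
    by (intro tendsto_Lim cdf_at_left) simp
  moreover have "{..of_int k * h} = {..<of_int k * h} \<union> {of_int k * h}" by auto
  hence "cdf T (of_int k * h) = measure T {..<of_int k * h} + measure T {of_int k * h}"
    unfolding cdf_def by (simp only:) (rule finite_measure_Union, auto)
  ultimately show ?thesis unfolding lattice_mass_def by simp
qed

text \<open>On a countable discrete space a measure is the density of its point masses with respect
  to the counting measure.\<close>

lemma integral_int_count_space:
  fixes f :: "int \<Rightarrow> real"
  assumes "prob_space P" and sets: "sets P = UNIV"
    and f: "\<And>k. \<bar>f k\<bar> \<le> S"
  shows "(\<integral>k. f k \<partial>P) = (\<integral>k. measure P {k} * f k \<partial>count_space UNIV)"
    and "integrable (count_space UNIV) (\<lambda>k. measure P {k} * f k)"
proof -
  interpret prob_space P by fact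
  have P: "P = density (count_space UNIV) (\<lambda>k. ennreal (measure P {k}))" (is "_ = ?D")
  proof (rule measure_eqI_countable[where A = UNIV])
    show "emeasure P {a} = emeasure ?D {a}" for a
      by (subst emeasure_density) (auto simp: nn_integral_count_space_indicator[symmetric]
          emeasure_eq_measure)
  qed (auto simp: sets)
  have "space P = UNIV" using sets sets.top[of P] by (metis UNIV_I sets.sets_into_space top.extremum_uniqueI)
  have [measurable]: "f \<in> borel_measurable P" using sets \<open>space P = UNIV\<close> by (simp add: measurable_def)
  have fi: "integrable P f" by (rule integrable_const_bound[of _ S]) (use f in auto)
  show "(\<integral>k. f k \<partial>P) = (\<integral>k. measure P {k} * f k \<partial>count_space UNIV)"
    by (subst P, subst integral_density) auto
  show "integrable (count_space UNIV) (\<lambda>k. measure P {k} * f k)"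
    using fi by (subst (asm) P, subst (asm) integrable_density) auto
qed

locale tilted_lattice = prob_space M for M :: "'a measure" +
  fixes A :: "'a \<Rightarrow> real" and \<kappa> h \<theta> :: real
  assumes \<kappa>_pos: "\<kappa> > 0" and h_pos: "h > 0"
    and A_measurable [measurable]: "A \<in> borel_measurable M"
    and A_integrable: "integrable M (\<lambda>\<omega>. A \<omega> powr \<kappa>)"
    and A_expectation: "expectation (\<lambda>\<omega>. A \<omega> powr \<kappa>) = \<theta>"
    and \<theta>_pos: "\<theta> > 0"
    and A_lattice: "AE \<omega> in M. A \<omega> = 0 \<or> (\<exists>k::int. A \<omega> = exp (of_int k * h))"
begin

definition tilted :: "'a measure" where
  "tilted = density M (\<lambda>\<omega>. ennreal (A \<omega> powr \<kappa> / \<theta>))"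

text \<open>The floor gives an integer-valued measurable function on the whole space; almost
  everywhere under \<open>tilted\<close> the quotient is already an integer.\<close>

definition log_index :: "'a \<Rightarrow> int" where "log_index \<omega> = \<lfloor>ln (A \<omega>) / h\<rfloor>"

definition mass :: "int \<Rightarrow> real" where
  "mass k = measure tilted {\<omega> \<in> space M. log_index \<omega> = k}"

lemma space_tilted [simp]: "space tilted = space M"
  and sets_tilted [simp, measurable_cong]: "sets tilted = sets M"
  by (simp_all add: tilted_def)

lemma log_index_measurable [measurable]: "log_index \<in> measurable M (count_space UNIV)"
  unfolding log_index_def by measurable

lemma log_index_exp [simp]: "A \<omega> = exp (of_int k * h) \<Longrightarrow> log_index \<omega> = k"
  using h_pos by (simp add: log_index_def)

sublocale tilted: prob_space tilted
proof
  have "emeasure tilted (space tilted) = (\<integral>\<^sup>+\<omega>. ennreal (A \<omega> powr \<kappa> / \<theta>) \<partial>M)"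
    unfolding tilted_def by (subst emeasure_density) (auto intro!: nn_integral_cong)
  also have "\<dots> = ennreal (\<integral>\<omega>. A \<omega> powr \<kappa> / \<theta> \<partial>M)"
    using A_integrable \<theta>_pos by (intro nn_integral_eq_integral) auto
  finally show "emeasure tilted (space tilted) = 1" using A_expectation \<theta>_pos by simp
qed

lemma integral_tilted:
  assumes [measurable]: "f \<in> borel_measurable M"
  shows "expectation (\<lambda>\<omega>. A \<omega> powr \<kappa> * f \<omega>) = \<theta> * (\<integral>\<omega>. f \<omega> \<partial>tilted)"
  unfolding tilted_def using \<theta>_pos by (subst integral_density) auto

text \<open>The density of \<open>tilted\<close> vanishes where \<open>A\<close> is 0, so only the
  lattice values of \<open>A\<close> survive, and on them the floor is exact.\<close>

lemma tilted_nonzero: "AE \<omega> in tilted. A \<omega> = exp (of_int (log_index \<omega>) * h)"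
proof -
  have "AE \<omega> in M. 0 < ennreal (A \<omega> powr \<kappa> / \<theta>) \<longrightarrow> A \<omega> = exp (of_int (log_index \<omega>) * h)"
    using A_lattice
  proof eventually_elim
    case (elim \<omega>)
    thus ?case using log_index_exp by fastforce
  qed
  thus ?thesis unfolding tilted_def by (subst AE_density) auto
qed

lemma mass_nonneg: "mass k \<ge> 0"
  by (simp add: mass_def)

lemma expectation_mass:
  assumes f: "\<And>k. \<bar>f k\<bar> \<le> S"
  shows "(\<integral>\<omega>. f (log_index \<omega>) \<partial>tilted) = (\<integral>k. mass k * f k \<partial>count_space UNIV)"
    and "integrable (count_space UNIV) (\<lambda>k. mass k * f k)"
proof -
  let ?P = "distr tilted (count_space UNIV) log_index"
  have P: "prob_space ?P" by (rule tilted.prob_space_distr) simp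
  have m: "measure ?P {k} = mass k" for k
    unfolding mass_def by (subst measure_distr) (auto intro!: arg_cong[where f = "measure tilted"])
  show "(\<integral>\<omega>. f (log_index \<omega>) \<partial>tilted) = (\<integral>k. mass k * f k \<partial>count_space UNIV)"
    using integral_int_count_space(1)[OF P _ f] unfolding m by (simp add: integral_distr)
  show "integrable (count_space UNIV) (\<lambda>k. mass k * f k)"
    using integral_int_count_space(2)[OF P _ f] unfolding m by simp
qed

lemma mass_integrable: "integrable (count_space UNIV) mass"
  using expectation_mass(2)[of "\<lambda>_. 1" 1] by simp

lemma mass_total: "(\<integral>k. mass k \<partial>count_space UNIV) = 1"
  using expectation_mass(1)[of "\<lambda>_. 1" 1] tilted.prob_space by simp

text \<open>On the event that \<open>A\<close> equals \<open>exp (k * h)\<close> the factor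
  \<open>A powr \<kappa>\<close> is constant. Where \<open>A\<close> vanishes, the index is an
  artefact of \<open>ln 0\<close>, but \<open>A powr \<kappa>\<close> is 0.\<close>

lemma mass_eq: "\<theta> * mass k = exp (\<kappa> * of_int k * h) * prob {\<omega> \<in> space M. A \<omega> = exp (of_int k * h)}"
proof -
  have "mass k = (\<integral>\<omega>. indicator {\<omega> \<in> space M. log_index \<omega> = k} \<omega> \<partial>tilted)"
    unfolding mass_def by simp
  hence "\<theta> * mass k = expectation (\<lambda>\<omega>. A \<omega> powr \<kappa> * indicator {\<omega> \<in> space M. log_index \<omega> = k} \<omega>)"
    by (subst integral_tilted) auto
  also have "\<dots> = expectation (\<lambda>\<omega>. exp (\<kappa> * of_int k * h) *
      indicator {\<omega> \<in> space M. A \<omega> = exp (of_int k * h)} \<omega>)"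
  proof (rule integral_cong_AE)
    show "AE \<omega> in M. A \<omega> powr \<kappa> * indicator {\<omega> \<in> space M. log_index \<omega> = k} \<omega> =
       exp (\<kappa> * of_int k * h) * indicator {\<omega> \<in> space M. A \<omega> = exp (of_int k * h)} \<omega>"
      using A_lattice by eventually_elim (auto simp: indicator_def powr_def algebra_simps)
  qed auto
  also have "\<dots> = exp (\<kappa> * of_int k * h) * prob {\<omega> \<in> space M. A \<omega> = exp (of_int k * h)}"
    by simp
  finally show ?thesis .
qed

section \<open>The law of log A under the tilted measure\<close>

definition tilted_log :: "real measure" where
  "tilted_log = distr tilted borel (\<lambda>\<omega>. ln (A \<omega>))"

sublocale tilted_log: real_distribution tilted_log
  unfolding tilted_log_def by (rule tilted.real_distribution_distr) simp

lemma tilted_cdf_eq: "tilted_cdf M A \<kappa> = cdf tilted_log"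
proof
  fix x
  have "cdf tilted_log x = measure tilted {\<omega> \<in> space M. ln (A \<omega>) \<le> x}"
    unfolding tilted_log_def cdf_def
    by (subst measure_distr) (auto intro!: arg_cong[where f = "measure tilted"])
  also have "\<dots> = (\<integral>\<omega>. indicator {\<omega> \<in> space M. ln (A \<omega>) \<le> x} \<omega> \<partial>tilted)"
    by simp
  also have "\<dots> = expectation (\<lambda>\<omega>. A \<omega> powr \<kappa> * indicator {\<omega> \<in> space M. ln (A \<omega>) \<le> x} \<omega>) / \<theta>"
    using \<theta>_pos by (subst integral_tilted) auto
  also have "expectation (\<lambda>\<omega>. A \<omega> powr \<kappa> * indicator {\<omega> \<in> space M. ln (A \<omega>) \<le> x} \<omega>) =
     expectation (\<lambda>\<omega>. indicator {\<omega>. ln (A \<omega>) \<le> x} \<omega> * A \<omega> powr \<kappa>)"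
    by (rule Bochner_Integration.integral_cong) (auto simp: indicator_def)
  finally show "tilted_cdf M A \<kappa> x = cdf tilted_log x"
    unfolding tilted_cdf_def A_expectation by simp
qed

lemma tilted_log_singleton: "measure tilted_log {of_int k * h} = mass k"
proof -
  have "measure tilted_log {of_int k * h} = measure tilted {\<omega> \<in> space M. ln (A \<omega>) = of_int k * h}"
    unfolding tilted_log_def
    by (subst measure_distr) (auto intro!: arg_cong[where f = "measure tilted"])
  also have "\<dots> = mass k" unfolding mass_def
  proof (rule tilted.finite_measure_eq_AE)
    show "AE \<omega> in tilted. (\<omega> \<in> {\<omega> \<in> space M. ln (A \<omega>) = of_int k * h}) =
        (\<omega> \<in> {\<omega> \<in> space M. log_index \<omega> = k})"
      using tilted_nonzero
    proof eventually_elim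
      case (elim \<omega>)
      hence "ln (A \<omega>) = of_int (log_index \<omega>) * h" by (metis ln_exp)
      thus ?case using h_pos by auto
    qed
  qed auto
  finally show ?thesis .
qed

lemma lattice_mass_tilted_cdf: "lattice_mass h (tilted_cdf M A \<kappa>) k = mass k"
  unfolding tilted_cdf_eq
  by (simp add: lattice_mass_cdf tilted_log.finite_borel_measure_M tilted_log_singleton)

lemma nn_integral_tilted_log:
  assumes "f \<in> borel_measurable borel"
  shows "(\<integral>\<^sup>+x. f x \<partial>tilted_log) = (\<integral>\<^sup>+\<omega>. f (ln (A \<omega>)) \<partial>tilted)"
  unfolding tilted_log_def by (rule nn_integral_distr) (use assms in auto)

lemma lattice_mass_convolution:
  "lattice_mass h (cdf_convolution (tilted_cdf M A \<kappa>) (tilted_cdf M A \<kappa>)) n =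
     (\<integral>j. mass (n - j) * mass j \<partial>count_space UNIV)"
proof -
  let ?T = tilted_log
  have cont: "continuous (at_right a) (cdf ?T)" for a by (rule tilted_log.cdf_is_right_cont)
  \<comment> \<open>\<open>cdf_convolution\<close> passes through interval measures; recovering
    \<open>tilted_log\<close> from its distribution function turns it into a convolution of
    measures.\<close>
  have I: "interval_measure (cdf ?T) = ?T"
  proof (rule cdf_unique)
    show "real_distribution (interval_measure (cdf ?T))"
      by (intro real_distribution_interval_measure tilted_log.cdf_nondecreasing cont
            tilted_log.cdf_lim_at_bot tilted_log.cdf_lim_at_top_prob)
    show "cdf (interval_measure (cdf ?T)) = cdf ?T"
      by (intro cdf_interval_measure tilted_log.cdf_nondecreasing cont tilted_log.cdf_lim_at_bot)
  qed (rule tilted_log.real_distribution_axioms)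
  have fin: "finite_measure ?T" by unfold_locales
  interpret conv: finite_borel_measure "?T \<star> ?T"
    using convolution_finite[OF fin fin] by (simp add: finite_borel_measure_def finite_borel_measure_axioms_def)
  have "emeasure (?T \<star> ?T) {of_int n * h} = (\<integral>\<^sup>+x. emeasure ?T {a. a + x \<in> {of_int n * h}} \<partial>?T)"
    by (rule convolution_emeasure) (auto simp: fin)
  also have "\<dots> = (\<integral>\<^sup>+x. ennreal (measure ?T {of_int n * h - x}) \<partial>?T)"
    by (intro nn_integral_cong)
       (simp add: tilted_log.emeasure_eq_measure[symmetric] eq_diff_eq[symmetric])
  also have "\<dots> = (\<integral>\<^sup>+\<omega>. ennreal (mass (n - log_index \<omega>)) \<partial>tilted)"
  proof -
    \<comment> \<open>Measurability in \<open>x\<close> of the point mass at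
      \<open>n * h - x\<close> follows from writing it as an integral with parameter
      \<open>x\<close>.\<close>
    have "(\<lambda>x. \<integral>\<^sup>+y. indicator {of_int n * h} (x + y) \<partial>?T) \<in> borel_measurable borel"
      by measurable
    moreover have "(\<integral>\<^sup>+y. indicator {of_int n * h} (x + y) \<partial>?T) = ennreal (measure ?T {of_int n * h - x})" for x
    proof -
      have "(\<integral>\<^sup>+y. indicator {of_int n * h} (x + y) \<partial>?T) = (\<integral>\<^sup>+y. indicator {of_int n * h - x} y \<partial>?T)"
        by (intro nn_integral_cong) (auto simp: indicator_def)
      thus ?thesis by (simp add: tilted_log.emeasure_eq_measure)
    qed
    ultimately have [measurable]: "(\<lambda>x. ennreal (measure ?T {of_int n * h - x})) \<in> borel_measurable borel"
      by simp
    have "(\<integral>\<^sup>+x. ennreal (measure ?T {of_int n * h - x}) \<partial>?T) =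
       (\<integral>\<^sup>+\<omega>. ennreal (measure ?T {of_int n * h - ln (A \<omega>)}) \<partial>tilted)"
      by (rule nn_integral_tilted_log) measurable
    also have "\<dots> = (\<integral>\<^sup>+\<omega>. ennreal (mass (n - log_index \<omega>)) \<partial>tilted)"
    proof (rule nn_integral_cong_AE)
      show "AE \<omega> in tilted. ennreal (measure ?T {of_int n * h - ln (A \<omega>)}) = ennreal (mass (n - log_index \<omega>))"
        using tilted_nonzero
      proof eventually_elim
        case (elim \<omega>)
        hence "ln (A \<omega>) = of_int (log_index \<omega>) * h" by (metis ln_exp)
        hence "of_int n * h - ln (A \<omega>) = of_int (n - log_index \<omega>) * h" by (simp add: algebra_simps)
        thus ?case by (simp only: tilted_log_singleton)
      qed
    qed
    finally show ?thesis .
  qed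
  also have "\<dots> = ennreal (\<integral>\<omega>. mass (n - log_index \<omega>) \<partial>tilted)"
    by (intro nn_integral_eq_integral tilted.integrable_const_bound[of _ 1])
       (auto simp: mass_def)
  also have "(\<integral>\<omega>. mass (n - log_index \<omega>) \<partial>tilted) = (\<integral>k. mass k * mass (n - k) \<partial>count_space UNIV)"
    by (rule expectation_mass(1)[where S = 1]) (simp add: mass_def)
  finally have "measure (?T \<star> ?T) {of_int n * h} = (\<integral>k. mass k * mass (n - k) \<partial>count_space UNIV)"
    by (simp add: conv.emeasure_eq_measure mass_nonneg)
  thus ?thesis
    unfolding cdf_convolution_def tilted_cdf_eq I
    by (subst lattice_mass_cdf) (simp_all add: conv.finite_borel_measure_axioms mult.commute)
qed

end

subsection \<open>Tail bounds for perpetuities\<close>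

locale lattice_perpetuity = tilted_lattice M A \<kappa> h \<theta> + N: prob_space N
  for M :: "'a measure" and A :: "'a \<Rightarrow> real" and \<kappa> h \<theta> :: real and N :: "'b measure" +
  fixes B :: "'a \<Rightarrow> real" and X :: "'b \<Rightarrow> real" and \<nu> :: real
  assumes \<theta>_less: "\<theta> < 1"
    and B_measurable [measurable]: "B \<in> borel_measurable M"
    and \<nu>_greater: "\<nu> > \<kappa>"
    and B_integrable: "integrable M (\<lambda>\<omega>. \<bar>B \<omega>\<bar> powr \<nu>)"
    and solution: "perpetuity_solution M A B N X"
begin

lemma X_measurable [measurable]: "X \<in> borel_measurable N"
  using solution by (simp add: perpetuity_solution_def)

sublocale P: pair_prob_space M N ..

lemma A_nonneg: "AE \<omega> in M. A \<omega> \<ge> 0"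
  using A_lattice by eventually_elim auto

lemma integrable_pair:
  fixes f :: "'a \<Rightarrow> 'b \<Rightarrow> real"
  assumes "(\<lambda>(\<omega>, \<eta>). f \<omega> \<eta>) \<in> borel_measurable (M \<Otimes>\<^sub>M N)" and "\<And>\<omega> \<eta>. \<bar>f \<omega> \<eta>\<bar> \<le> S"
  shows "integrable (M \<Otimes>\<^sub>M N) (\<lambda>(\<omega>, \<eta>). f \<omega> \<eta>)"
  by (rule P.integrable_const_bound[of _ S]) (use assms in \<open>auto split: prod.split\<close>)

text \<open>The equation in law, tested with a bounded function; boundedness is what justifies
  Fubini. Here \<open>X\<close> is held fixed in the inner integral, in
  \<open>solution_integral_fst\<close> the pair of coefficients is.\<close>

lemma solution_integral:
  fixes f :: "real \<Rightarrow> real"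
  assumes [measurable]: "f \<in> borel_measurable borel" and S: "\<And>x. \<bar>f x\<bar> \<le> S"
  shows "N.expectation (\<lambda>\<eta>. f (X \<eta>)) = (\<integral>(\<omega>, \<eta>). f (A \<omega> * X \<eta> + B \<omega>) \<partial>(M \<Otimes>\<^sub>M N))"
    and "N.expectation (\<lambda>\<eta>. f (X \<eta>)) = N.expectation (\<lambda>\<eta>. expectation (\<lambda>\<omega>. f (A \<omega> * X \<eta> + B \<omega>)))"
proof -
  have "N.expectation (\<lambda>\<eta>. f (X \<eta>)) = (\<integral>x. f x \<partial>distr N borel X)"
    by (simp add: integral_distr)
  also have "\<dots> = (\<integral>x. f x \<partial>distr (M \<Otimes>\<^sub>M N) borel (\<lambda>(\<omega>, \<eta>). A \<omega> * X \<eta> + B \<omega>))"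
    using solution by (simp add: perpetuity_solution_def)
  also have "\<dots> = (\<integral>z. f ((\<lambda>(\<omega>, \<eta>). A \<omega> * X \<eta> + B \<omega>) z) \<partial>(M \<Otimes>\<^sub>M N))"
    by (rule integral_distr) auto
  finally show 1: "N.expectation (\<lambda>\<eta>. f (X \<eta>)) = (\<integral>(\<omega>, \<eta>). f (A \<omega> * X \<eta> + B \<omega>) \<partial>(M \<Otimes>\<^sub>M N))"
    by (simp add: case_prod_unfold)
  show "N.expectation (\<lambda>\<eta>. f (X \<eta>)) = N.expectation (\<lambda>\<eta>. expectation (\<lambda>\<omega>. f (A \<omega> * X \<eta> + B \<omega>)))"
    unfolding 1 by (rule P.integral_snd[symmetric], rule integrable_pair[of _ S]) (auto simp: S)
qed

lemma solution_integral_fst: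
  fixes f :: "real \<Rightarrow> real"
  assumes [measurable]: "f \<in> borel_measurable borel" and S: "\<And>x. \<bar>f x\<bar> \<le> S"
  shows "N.expectation (\<lambda>\<eta>. f (X \<eta>)) = expectation (\<lambda>\<omega>. N.expectation (\<lambda>\<eta>. f (A \<omega> * X \<eta> + B \<omega>)))"
  unfolding solution_integral(1)[OF assms]
  by (rule P.integral_fst[symmetric], rule integrable_pair[of _ S]) (auto simp: S)

section \<open>Moments of order \<kappa> and the resulting tail bounds\<close>

lemma B_integrable_\<kappa>: "integrable M (\<lambda>\<omega>. \<bar>B \<omega>\<bar> powr \<kappa>)"
proof (rule Bochner_Integration.integrable_bound)
  show "integrable M (\<lambda>\<omega>. 1 + \<bar>B \<omega>\<bar> powr \<nu>)" using B_integrable by simp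
  show "AE \<omega> in M. norm (\<bar>B \<omega>\<bar> powr \<kappa>) \<le> norm (1 + \<bar>B \<omega>\<bar> powr \<nu>)"
  proof (rule AE_I2)
    fix \<omega>
    have "\<bar>B \<omega>\<bar> powr \<kappa> \<le> 1 + \<bar>B \<omega>\<bar> powr \<nu>"
    proof (cases "\<bar>B \<omega>\<bar> \<le> 1")
      case True
      hence "\<bar>B \<omega>\<bar> powr \<kappa> \<le> 1" using \<kappa>_pos by (intro powr_le1) auto
      thus ?thesis by (simp add: add_increasing2)
    next
      case False
      hence "\<bar>B \<omega>\<bar> powr \<kappa> \<le> \<bar>B \<omega>\<bar> powr \<nu>" using \<nu>_greater by (intro powr_mono) auto
      thus ?thesis by simp
    qed
    thus "norm (\<bar>B \<omega>\<bar> powr \<kappa>) \<le> norm (1 + \<bar>B \<omega>\<bar> powr \<nu>)" by simp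
  qed
qed simp

text \<open>Truncating at \<open>K\<close> keeps all expectations finite before anything is known about the moments of \<open>X\<close>;
  concavity of \<open>min K\<close> lets the recursion contract inside the truncation, as long as \<open>\<theta> d\<^sup>\<kappa> < 1\<close>.
  Either \<open>\<bar>B\<bar> \<le> (d - 1) A \<bar>x\<bar>\<close> and \<open>\<bar>A x + B\<bar> \<le> d A \<bar>x\<bar>\<close>, or \<open>\<bar>A x + B\<bar> \<le> d / (d - 1) \<bar>B\<bar>\<close>.\<close>

lemma truncated_moment_step:
  assumes d: "d > 1" and K: "K \<ge> 0" and s: "s \<ge> 0" and c: "c \<ge> 0"
  defines "c' \<equiv> (d / (d - 1)) powr \<kappa> * expectation (\<lambda>\<omega>. \<bar>B \<omega>\<bar> powr \<kappa>)"
  shows "N.expectation (\<lambda>\<eta>. min K (s * \<bar>X \<eta>\<bar> powr \<kappa> + c)) \<le>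
         N.expectation (\<lambda>\<eta>. min K (s * (\<theta> * d powr \<kappa>) * \<bar>X \<eta>\<bar> powr \<kappa> + (c + s * c')))"
proof -
  let ?F = "\<lambda>x. min K (s * \<bar>x\<bar> powr \<kappa> + c)"
  have bd: "\<bar>?F x\<bar> \<le> K" for x using K s c by (auto simp: min_def)
  have c': "c' \<ge> 0" unfolding c'_def by (intro mult_nonneg_nonneg Bochner_Integration.integral_nonneg) auto
  have pw: "\<bar>a * x + b\<bar> powr \<kappa> \<le> d powr \<kappa> * \<bar>x\<bar> powr \<kappa> * a powr \<kappa> + (d / (d - 1)) powr \<kappa> * \<bar>b\<bar> powr \<kappa>"
    if "a \<ge> 0" for a b x :: real
  proof (cases "\<bar>b\<bar> \<le> a * \<bar>x\<bar> * (d - 1)")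
    case True
    have "\<bar>a * x + b\<bar> \<le> a * \<bar>x\<bar> + \<bar>b\<bar>" using that by (simp add: abs_mult order_trans[OF abs_triangle_ineq])
    also have "\<dots> \<le> d * \<bar>x\<bar> * a" using True by (simp add: algebra_simps)
    finally have "\<bar>a * x + b\<bar> powr \<kappa> \<le> (d * \<bar>x\<bar> * a) powr \<kappa>" using \<kappa>_pos by (intro powr_mono2) auto
    also have "\<dots> = d powr \<kappa> * \<bar>x\<bar> powr \<kappa> * a powr \<kappa>" using d that by (simp add: powr_mult)
    finally show ?thesis by (simp add: add_increasing2)
  next
    case False
    have "\<bar>a * x + b\<bar> \<le> a * \<bar>x\<bar> + \<bar>b\<bar>" using that by (simp add: abs_mult order_trans[OF abs_triangle_ineq])
    also have "\<dots> \<le> d / (d - 1) * \<bar>b\<bar>" using False d by (simp add: field_simps)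
    finally have "\<bar>a * x + b\<bar> powr \<kappa> \<le> (d / (d - 1) * \<bar>b\<bar>) powr \<kappa>" using \<kappa>_pos by (intro powr_mono2) auto
    also have "\<dots> = (d / (d - 1)) powr \<kappa> * \<bar>b\<bar> powr \<kappa>" by (rule powr_mult)
    finally show ?thesis by (simp add: add_increasing)
  qed
  have inner: "expectation (\<lambda>\<omega>. ?F (A \<omega> * x + B \<omega>)) \<le>
      min K (s * (\<theta> * d powr \<kappa>) * \<bar>x\<bar> powr \<kappa> + (c + s * c'))" for x
  proof -
    let ?u = "\<lambda>\<omega>. s * (d powr \<kappa> * \<bar>x\<bar> powr \<kappa> * A \<omega> powr \<kappa> + (d / (d - 1)) powr \<kappa> * \<bar>B \<omega>\<bar> powr \<kappa>) + c"
    have iF: "integrable M (\<lambda>\<omega>. ?F (A \<omega> * x + B \<omega>))"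
      by (rule integrable_const_bound[of _ K]) (use bd in auto)
    have iu: "integrable M ?u" using A_integrable B_integrable_\<kappa> by simp
    \<comment> \<open>Jensen's inequality for the concave \<open>min K\<close> by hand: the
      expectation is at most \<open>K\<close> and at most the expectation of the untruncated
      bound.\<close>
    have "expectation (\<lambda>\<omega>. ?F (A \<omega> * x + B \<omega>)) \<le> expectation (\<lambda>\<omega>. K)"
      by (rule integral_mono[OF iF]) auto
    moreover have "expectation (\<lambda>\<omega>. ?F (A \<omega> * x + B \<omega>)) \<le> expectation ?u"
    proof (rule integral_mono_AE[OF iF iu])
      show "AE \<omega> in M. ?F (A \<omega> * x + B \<omega>) \<le> ?u \<omega>"
        using A_nonneg
      proof eventually_elim
        case (elim \<omega>)
        have "s * \<bar>A \<omega> * x + B \<omega>\<bar> powr \<kappa> + c \<le> ?u \<omega>"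
          using pw[OF elim] s by (intro add_right_mono mult_left_mono) auto
        thus ?case by (rule min.coboundedI2)
      qed
    qed
    moreover have "expectation ?u = s * (\<theta> * d powr \<kappa>) * \<bar>x\<bar> powr \<kappa> + (c + s * c')"
      using A_integrable B_integrable_\<kappa> A_expectation
      by (simp add: prob_space c'_def algebra_simps)
    ultimately show ?thesis using prob_space by simp
  qed
  have "N.expectation (\<lambda>\<eta>. ?F (X \<eta>)) = N.expectation (\<lambda>\<eta>. expectation (\<lambda>\<omega>. ?F (A \<omega> * X \<eta> + B \<omega>)))"
    by (rule solution_integral(2)[OF _ bd]) measurable
  also have "\<dots> \<le> N.expectation (\<lambda>\<eta>. min K (s * (\<theta> * d powr \<kappa>) * \<bar>X \<eta>\<bar> powr \<kappa> + (c + s * c')))"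
  proof (rule integral_mono)
    show "integrable N (\<lambda>\<eta>. expectation (\<lambda>\<omega>. ?F (A \<omega> * X \<eta> + B \<omega>)))"
      by (rule P.integrable_snd, rule integrable_pair[of _ K]) (use bd in auto)
    show "integrable N (\<lambda>\<eta>. min K (s * (\<theta> * d powr \<kappa>) * \<bar>X \<eta>\<bar> powr \<kappa> + (c + s * c')))"
      by (rule N.integrable_const_bound[of _ K]) (use K s c c' \<theta>_pos in \<open>auto simp: abs_le_iff min_le_iff_disj intro!: AE_I2\<close>)
  qed (rule inner)
  finally show ?thesis .
qed

text \<open>After \<open>n\<close> steps the coefficient of the moment is \<open>r ^ n\<close>, and
  the constants form a geometric sum below \<open>c' / (1 - r)\<close>. Inside the truncation
  \<open>n\<close> may tend to infinity, with \<open>K\<close> as majorant, which leaves a bound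
  free of \<open>K\<close>.\<close>

lemma truncated_moment:
  shows "\<exists>C\<ge>0. \<forall>K\<ge>0. N.expectation (\<lambda>\<eta>. min K (\<bar>X \<eta>\<bar> powr \<kappa>)) \<le> C"
proof -
  \<comment> \<open>This choice makes \<theta> d^\<kappa> the square root of \<theta>, which is
    below 1, while \<open>d > 1\<close> holds because \<theta> < 1.\<close>
  define d where "d = \<theta> powr (- 1 / (2 * \<kappa>))"
  have d: "d > 1" unfolding d_def using \<theta>_pos \<theta>_less \<kappa>_pos powr_less_mono2_neg[of "- 1 / (2 * \<kappa>)" \<theta> 1] by simp
  define r where "r = \<theta> * d powr \<kappa>"
  have r_eq: "r = \<theta> powr (1 / 2)"
    unfolding r_def d_def powr_powr using \<theta>_pos \<kappa>_pos
    by (simp add: powr_mult_base field_simps)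
  have r: "0 < r" "r < 1" unfolding r_eq using \<theta>_pos \<theta>_less powr_less_mono2[of "1 / 2" \<theta> 1] by auto
  define c' where "c' = (d / (d - 1)) powr \<kappa> * expectation (\<lambda>\<omega>. \<bar>B \<omega>\<bar> powr \<kappa>)"
  have c': "c' \<ge> 0" unfolding c'_def by (intro mult_nonneg_nonneg Bochner_Integration.integral_nonneg) auto
  have "N.expectation (\<lambda>\<eta>. min K (\<bar>X \<eta>\<bar> powr \<kappa>)) \<le> c' / (1 - r)" if K: "K \<ge> 0" for K
  proof -
    have iter: "N.expectation (\<lambda>\<eta>. min K (\<bar>X \<eta>\<bar> powr \<kappa>)) \<le>
      N.expectation (\<lambda>\<eta>. min K (r ^ n * \<bar>X \<eta>\<bar> powr \<kappa> + c' * (\<Sum>i<n. r ^ i)))" for n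
    proof (induction n)
      case (Suc n)
      have "N.expectation (\<lambda>\<eta>. min K (r ^ n * \<bar>X \<eta>\<bar> powr \<kappa> + c' * (\<Sum>i<n. r ^ i))) \<le>
        N.expectation (\<lambda>\<eta>. min K (r ^ n * (\<theta> * d powr \<kappa>) * \<bar>X \<eta>\<bar> powr \<kappa> + (c' * (\<Sum>i<n. r ^ i) + r ^ n * c')))"
        unfolding c'_def by (rule truncated_moment_step)
          (use d K r c'[unfolded c'_def] in \<open>auto intro!: mult_nonneg_nonneg sum_nonneg\<close>)
      with Suc show ?case by (simp add: r_def[symmetric] algebra_simps)
    qed simp
    have "N.expectation (\<lambda>\<eta>. min K (\<bar>X \<eta>\<bar> powr \<kappa>)) \<le>
      N.expectation (\<lambda>\<eta>. min K (r ^ n * \<bar>X \<eta>\<bar> powr \<kappa> + c' / (1 - r)))" for n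
    proof (rule order_trans[OF iter[of n]], rule integral_mono)
      have "(\<Sum>i<n. r ^ i) \<le> 1 / (1 - r)" using r by (simp add: sum_gp_strict divide_right_mono)
      from mult_left_mono[OF this c'] have "c' * (\<Sum>i<n. r ^ i) \<le> c' / (1 - r)" by simp
      thus "min K (r ^ n * \<bar>X \<eta>\<bar> powr \<kappa> + c' * (\<Sum>i<n. r ^ i)) \<le>
        min K (r ^ n * \<bar>X \<eta>\<bar> powr \<kappa> + c' / (1 - r))" for \<eta>
        by (intro min.mono) auto
      have "0 \<le> c' * (\<Sum>i<n. r ^ i)" using c' r by (intro mult_nonneg_nonneg sum_nonneg) auto
      thus "integrable N (\<lambda>\<eta>. min K (r ^ n * \<bar>X \<eta>\<bar> powr \<kappa> + c' * (\<Sum>i<n. r ^ i)))"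
        by (intro N.integrable_const_bound[of _ K])
           (use K r in \<open>auto simp: abs_le_iff min_le_iff_disj intro!: AE_I2\<close>)
      have "0 \<le> c' / (1 - r)" using c' r by simp
      thus "integrable N (\<lambda>\<eta>. min K (r ^ n * \<bar>X \<eta>\<bar> powr \<kappa> + c' / (1 - r)))"
        by (intro N.integrable_const_bound[of _ K])
           (use K r in \<open>auto simp: abs_le_iff min_le_iff_disj intro!: AE_I2\<close>)
    qed
    moreover have "(\<lambda>n. N.expectation (\<lambda>\<eta>. min K (r ^ n * \<bar>X \<eta>\<bar> powr \<kappa> + c' / (1 - r)))) \<longlonglongrightarrow>
       N.expectation (\<lambda>\<eta>. min K (c' / (1 - r)))"
    proof (rule integral_dominated_convergence[where w = "\<lambda>_. K"])
      show "AE \<eta> in N. (\<lambda>n. min K (r ^ n * \<bar>X \<eta>\<bar> powr \<kappa> + c' / (1 - r))) \<longlonglongrightarrow> min K (c' / (1 - r))"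
      proof (rule AE_I2)
        fix \<eta>
        have "(\<lambda>n. min K (r ^ n * \<bar>X \<eta>\<bar> powr \<kappa> + c' / (1 - r))) \<longlonglongrightarrow> min K (0 * \<bar>X \<eta>\<bar> powr \<kappa> + c' / (1 - r))"
          using r by (intro tendsto_intros LIMSEQ_power_zero) auto
        thus "(\<lambda>n. min K (r ^ n * \<bar>X \<eta>\<bar> powr \<kappa> + c' / (1 - r))) \<longlonglongrightarrow> min K (c' / (1 - r))" by simp
      qed
      have "0 \<le> c' / (1 - r)" using c' r by simp
      thus "AE \<eta> in N. norm (min K (r ^ n * \<bar>X \<eta>\<bar> powr \<kappa> + c' / (1 - r))) \<le> K" for n
        using K r by (auto simp: abs_le_iff min_le_iff_disj intro!: AE_I2)
    qed auto
    ultimately have "N.expectation (\<lambda>\<eta>. min K (\<bar>X \<eta>\<bar> powr \<kappa>)) \<le> N.expectation (\<lambda>\<eta>. min K (c' / (1 - r)))"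
      by (intro LIMSEQ_le_const) auto
    also have "\<dots> \<le> c' / (1 - r)" by (simp add: N.prob_space)
    finally show ?thesis .
  qed
  moreover have "0 \<le> c' / (1 - r)" using c' r by simp
  ultimately show ?thesis by blast
qed

definition tail_const :: real where
  "tail_const = (SOME C. C \<ge> 0 \<and> (\<forall>K\<ge>0. N.expectation (\<lambda>\<eta>. min K (\<bar>X \<eta>\<bar> powr \<kappa>)) \<le> C))"

lemma tail_const: "tail_const \<ge> 0"
    "K \<ge> 0 \<Longrightarrow> N.expectation (\<lambda>\<eta>. min K (\<bar>X \<eta>\<bar> powr \<kappa>)) \<le> tail_const"
  using someI_ex[of "\<lambda>C. C \<ge> 0 \<and> (\<forall>K\<ge>0. N.expectation (\<lambda>\<eta>. min K (\<bar>X \<eta>\<bar> powr \<kappa>)) \<le> C)"]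
    truncated_moment unfolding tail_const_def[symmetric] by auto

text \<open>Markov's inequality with the truncation at \<open>K = t powr \<kappa>\<close>, where the
  truncated moment still dominates the indicator times \<open>t powr \<kappa>\<close>.\<close>

lemma tail_bound:
  assumes t: "t > 0"
  shows "N.prob {\<eta> \<in> space N. \<bar>X \<eta>\<bar> > t} \<le> tail_const * t powr (- \<kappa>)"
proof -
  have "t powr \<kappa> * N.prob {\<eta> \<in> space N. \<bar>X \<eta>\<bar> > t} =
     N.expectation (\<lambda>\<eta>. t powr \<kappa> * indicator {\<eta> \<in> space N. \<bar>X \<eta>\<bar> > t} \<eta>)"
    by simp
  also have "\<dots> \<le> N.expectation (\<lambda>\<eta>. min (t powr \<kappa>) (\<bar>X \<eta>\<bar> powr \<kappa>))"
  proof (rule integral_mono)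
    show "integrable N (\<lambda>\<eta>. min (t powr \<kappa>) (\<bar>X \<eta>\<bar> powr \<kappa>))"
      by (rule N.integrable_const_bound[of _ "t powr \<kappa>"]) (auto simp: abs_le_iff min_le_iff_disj)
    show "t powr \<kappa> * indicator {\<eta> \<in> space N. \<bar>X \<eta>\<bar> > t} \<eta> \<le> min (t powr \<kappa>) (\<bar>X \<eta>\<bar> powr \<kappa>)" for \<eta>
      using t \<kappa>_pos by (auto simp: indicator_def intro!: powr_mono2)
    show "integrable N (\<lambda>\<eta>. t powr \<kappa> * indicator {\<eta> \<in> space N. \<bar>X \<eta>\<bar> > t} \<eta>)"
      by (rule N.integrable_const_bound[of _ "t powr \<kappa>"]) (auto simp: indicator_def)
  qed
  also have "\<dots> \<le> tail_const" by (rule tail_const) simp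
  finally show ?thesis using t by (simp add: powr_minus field_simps)
qed

text \<open>For fixed \<open>A > 0\<close>, \<open>tail_bound\<close> at level \<open>t / A\<close>
  yields the factor \<open>A powr \<kappa>\<close>, whose expectation is \<theta>.\<close>

lemma tail_bound_product:
  assumes t: "t > 0"
  shows "P.prob {z \<in> space (M \<Otimes>\<^sub>M N). \<bar>A (fst z) * X (snd z)\<bar> > t} \<le> \<theta> * tail_const * t powr (- \<kappa>)"
proof -
  let ?S = "{z \<in> space (M \<Otimes>\<^sub>M N). \<bar>A (fst z) * X (snd z)\<bar> > t}"
  have S [measurable]: "?S \<in> sets (M \<Otimes>\<^sub>M N)" by measurable
  have i: "integrable (M \<Otimes>\<^sub>M N) (indicator ?S :: _ \<Rightarrow> real)"
    by (rule P.integrable_const_bound[of _ 1]) (auto simp: indicator_def)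
  have "P.prob ?S = (\<integral>z. indicator ?S z \<partial>(M \<Otimes>\<^sub>M N))" by simp
  also have "\<dots> = expectation (\<lambda>\<omega>. N.expectation (\<lambda>\<eta>. indicator ?S (\<omega>, \<eta>)))"
    by (rule P.integral_fst'[OF i, symmetric])
  also have "\<dots> \<le> expectation (\<lambda>\<omega>. tail_const * t powr (- \<kappa>) * A \<omega> powr \<kappa>)"
  proof (rule integral_mono_AE)
    show "integrable M (\<lambda>\<omega>. N.expectation (\<lambda>\<eta>. indicator ?S (\<omega>, \<eta>) :: real))"
      by (rule P.integrable_fst'[OF i])
    show "AE \<omega> in M. N.expectation (\<lambda>\<eta>. indicator ?S (\<omega>, \<eta>)) \<le> tail_const * t powr (- \<kappa>) * A \<omega> powr \<kappa>"
      using A_nonneg AE_space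
    proof eventually_elim
      case (elim \<omega>)
      show ?case
      proof (cases "A \<omega> = 0")
        case True
        thus ?thesis using t by (simp add: indicator_def)
      next
        case False
        with elim have a: "A \<omega> > 0" by simp
        have "N.expectation (\<lambda>\<eta>. indicator ?S (\<omega>, \<eta>)) =
            N.expectation (\<lambda>\<eta>. indicator {\<eta> \<in> space N. \<bar>X \<eta>\<bar> > t / A \<omega>} \<eta>)"
          using a elim(2) by (intro Bochner_Integration.integral_cong)
            (auto simp: indicator_def space_pair_measure abs_mult field_simps)
        also have "\<dots> = N.prob {\<eta> \<in> space N. \<bar>X \<eta>\<bar> > t / A \<omega>}" by simp
        also have "\<dots> \<le> tail_const * (t / A \<omega>) powr (- \<kappa>)"
          using a t by (intro tail_bound) simp
        also have "(t / A \<omega>) powr (- \<kappa>) = t powr (- \<kappa>) * A \<omega> powr \<kappa>"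
          using a t by (simp add: powr_divide powr_minus field_simps)
        finally show ?thesis by (simp add: mult.assoc)
      qed
    qed
  qed (use A_integrable in auto)
  also have "\<dots> = \<theta> * tail_const * t powr (- \<kappa>)" using A_expectation by simp
  finally show ?thesis .
qed

lemma B_tail_bound:
  assumes t: "t > 0"
  shows "prob {\<omega> \<in> space M. \<bar>B \<omega>\<bar> > t} \<le> expectation (\<lambda>\<omega>. \<bar>B \<omega>\<bar> powr \<nu>) * t powr (- \<nu>)"
proof -
  have "prob {\<omega> \<in> space M. \<bar>B \<omega>\<bar> > t} \<le> prob {\<omega> \<in> space M. \<bar>B \<omega>\<bar> powr \<nu> \<ge> t powr \<nu>}"
    using t \<kappa>_pos \<nu>_greater by (intro finite_measure_mono) (auto intro!: powr_mono2)
  also have "\<dots> \<le> expectation (\<lambda>\<omega>. \<bar>B \<omega>\<bar> powr \<nu>) / t powr \<nu>"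
    using t B_integrable by (intro integral_Markov_inequality_measure[of _ _ "{}"]) auto
  finally show ?thesis by (simp add: powr_minus_divide)
qed

end

subsection \<open>The implicit renewal equation\<close>

text \<open>The height \<open>b - a\<close> gives slope 1 and hence Lipschitz constant 1; indicators
  are recovered after division by \<open>b - a\<close>.\<close>

definition ramp :: "real \<Rightarrow> real \<Rightarrow> real \<Rightarrow> real" where
  "ramp a b y = min (max (y - a) 0) (b - a)"

lemma ramp_measurable [measurable]: "ramp a b \<in> borel_measurable borel"
  unfolding ramp_def by measurable

lemma ramp_bounds:
  assumes "a < b"
  shows "0 \<le> ramp a b y" "ramp a b y \<le> b - a"
  using assms by (auto simp: ramp_def)

lemma ramp_lipschitz: "\<bar>ramp a b y - ramp a b z\<bar> \<le> \<bar>y - z\<bar>"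
  by (auto simp: ramp_def min_def max_def abs_if)

lemma ramp_between:
  assumes "a < b"
  shows "(b - a) * indicator {b<..} y \<le> ramp a b y" "ramp a b y \<le> (b - a) * indicator {a<..} y"
  using assms by (auto simp: ramp_def indicator_def)

text \<open>Supplies summability at minus infinity for the scaled ramps, whose factor
  \<open>exp (\<kappa> * n * h)\<close> decays there.\<close>

lemma integrable_geometric_below:
  fixes c :: real
  assumes c: "c > 0"
  shows "integrable (count_space UNIV) (\<lambda>j::int. indicator {..<m} j * exp (c * of_int j))"
proof -
  have b: "bij_betw (\<lambda>n::nat. m - 1 - int n) UNIV {..<m}"
    by (rule bij_betwI[where g = "\<lambda>j. nat (m - 1 - j)"]) auto
  have "summable (\<lambda>n. exp (- c) ^ n)"
    by (rule summable_geometric) (use c in simp)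
  hence "summable (\<lambda>n. exp (c * of_int (m - 1)) * exp (- c) ^ n)"
    by (rule summable_mult)
  hence "summable (\<lambda>n. norm (exp (c * of_int (m - 1 - int n))))"
    by (simp add: exp_of_nat_mult[symmetric] mult_exp_exp algebra_simps)
  hence "integrable (count_space UNIV) (\<lambda>n::nat. exp (c * of_int (m - 1 - int n)))"
    by (simp add: integrable_count_space_nat_iff)
  hence "integrable (count_space {..<m}) (\<lambda>j. exp (c * of_int j))"
    using integrable_bij_count_space[OF b, of "\<lambda>j. exp (c * of_int j)"] by simp
  thus ?thesis
    using integrable_restrict_space[of "{..<m}" "count_space UNIV" "\<lambda>j. exp (c * of_int j)"]
    by (simp add: restrict_count_space)
qed

context lattice_perpetuity
begin

text \<open>If |B| > L, the difference is at most \<open>b - a\<close>. Otherwise it is at most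
  \<open>L * t\<close> by the Lipschitz bound, and it vanishes unless |A X| t > a / 2, since then
  both arguments are at most a / 2 + L t \<le> a, where the ramp is 0.\<close>

lemma ramp_difference_bound:
  assumes a: "0 < a" "a < b" and t: "t > 0" and L: "L > 0" "L * t \<le> a / 2"
  shows "\<bar>\<integral>(\<omega>, \<eta>). ramp a b ((A \<omega> * X \<eta> + B \<omega>) * t) - ramp a b (A \<omega> * X \<eta> * t) \<partial>(M \<Otimes>\<^sub>M N)\<bar> \<le>
    (b - a) * expectation (\<lambda>\<omega>. \<bar>B \<omega>\<bar> powr \<nu>) * L powr (- \<nu>)
    + L * t * (\<theta> * tail_const * (a / 2 / t) powr (- \<kappa>))"
proof -
  let ?D = "\<lambda>(\<omega>, \<eta>). ramp a b ((A \<omega> * X \<eta> + B \<omega>) * t) - ramp a b (A \<omega> * X \<eta> * t)"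
  let ?S = "{z \<in> space (M \<Otimes>\<^sub>M N). \<bar>A (fst z) * X (snd z)\<bar> > a / 2 / t}"
  let ?R = "{z \<in> space (M \<Otimes>\<^sub>M N). \<bar>B (fst z)\<bar> > L}"
  let ?u = "\<lambda>z. (b - a) * indicator ?R z + L * t * indicator ?S z"
  have [measurable]: "?S \<in> sets (M \<Otimes>\<^sub>M N)" "?R \<in> sets (M \<Otimes>\<^sub>M N)" by measurable
  have i: "integrable (M \<Otimes>\<^sub>M N) (indicator ?S :: _ \<Rightarrow> real)" "integrable (M \<Otimes>\<^sub>M N) (indicator ?R :: _ \<Rightarrow> real)"
    by (rule P.integrable_const_bound[of _ 1]; auto simp: indicator_def)+
  have "\<bar>\<integral>z. ?D z \<partial>(M \<Otimes>\<^sub>M N)\<bar> \<le> (\<integral>z. \<bar>?D z\<bar> \<partial>(M \<Otimes>\<^sub>M N))"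
    by (rule integral_abs_bound)
  also have "\<dots> \<le> (\<integral>z. ?u z \<partial>(M \<Otimes>\<^sub>M N))"
  proof (rule integral_mono)
    have bd: "\<bar>ramp a b y - ramp a b z\<bar> \<le> b - a" for y z
      using ramp_bounds[OF a(2), of y] ramp_bounds[OF a(2), of z] by (simp add: abs_le_iff)
    show "integrable (M \<Otimes>\<^sub>M N) (\<lambda>z. \<bar>?D z\<bar>)"
      by (intro integrable_abs integrable_pair[of _ "b - a"] bd) measurable
    show "integrable (M \<Otimes>\<^sub>M N) ?u" using i by simp
    fix z assume z: "z \<in> space (M \<Otimes>\<^sub>M N)"
    obtain \<omega> \<eta> where [simp]: "z = (\<omega>, \<eta>)" by (cases z)
    show "\<bar>?D z\<bar> \<le> ?u z"
    proof (cases "\<bar>B \<omega>\<bar> > L")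
      case True
      hence "?u z \<ge> b - a" using z L(1) t by (simp add: indicator_def)
      thus ?thesis using bd[of "(A \<omega> * X \<eta> + B \<omega>) * t" "A \<omega> * X \<eta> * t"] by simp
    next
      case False
      have "\<bar>B \<omega> * t\<bar> \<le> L * t" using False t by (simp add: abs_mult)
      hence le: "\<bar>?D z\<bar> \<le> L * t"
        using ramp_lipschitz[of a b "(A \<omega> * X \<eta> + B \<omega>) * t" "A \<omega> * X \<eta> * t"]
        by (simp add: algebra_simps)
      show ?thesis
      proof (cases "\<bar>A \<omega> * X \<eta>\<bar> > a / 2 / t")
        case True
        thus ?thesis using le False z a by (simp add: indicator_def)
      next
        case F2: False
        hence "A \<omega> * X \<eta> \<le> a / 2 / t" by linarith
        hence "A \<omega> * X \<eta> * t \<le> a / 2" using t by (simp add: field_simps)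
        moreover have "(A \<omega> * X \<eta> + B \<omega>) * t \<le> a"
          using calculation \<open>\<bar>B \<omega> * t\<bar> \<le> L * t\<close> L by (simp add: algebra_simps abs_le_iff)
        ultimately have "?D z = 0" using a by (simp add: ramp_def)
        thus ?thesis using a L t by (simp add: indicator_def)
      qed
    qed
  qed
  also have "\<dots> = (b - a) * P.prob ?R + L * t * P.prob ?S"
    using i by simp
  also have "P.prob ?R = prob {\<omega> \<in> space M. \<bar>B \<omega>\<bar> > L}"
  proof -
    have "?R = {\<omega> \<in> space M. \<bar>B \<omega>\<bar> > L} \<times> space N" by (auto simp: space_pair_measure)
    thus ?thesis by (simp add: measure_def N.emeasure_pair_measure_Times N.emeasure_space_1)
  qed
  also have "(b - a) * prob {\<omega> \<in> space M. \<bar>B \<omega>\<bar> > L} \<le>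
      (b - a) * (expectation (\<lambda>\<omega>. \<bar>B \<omega>\<bar> powr \<nu>) * L powr (- \<nu>))"
    using a by (intro mult_left_mono B_tail_bound L) auto
  also have "L * t * P.prob ?S \<le> L * t * (\<theta> * tail_const * (a / 2 / t) powr (- \<kappa>))"
    using a t L by (intro mult_left_mono tail_bound_product) auto
  finally show ?thesis by (simp add: mult.assoc)
qed

section \<open>Ingredients of positivity: a nonzero solution and one big jump\<close>

lemma solution_nonzero:
  assumes "prob {\<omega> \<in> space M. B \<omega> = 0} < 1"
  shows "\<exists>y>0. N.prob {\<eta> \<in> space N. \<bar>X \<eta>\<bar> > y} > 0"
proof (rule ccontr)
  assume neg: "\<not> ?thesis"
  have "AE \<eta> in N. \<bar>X \<eta>\<bar> \<le> inverse (real (Suc n))" for n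
  proof -
    have "N.prob {\<eta> \<in> space N. \<bar>X \<eta>\<bar> > inverse (real (Suc n))} = 0"
      using neg by (meson inverse_positive_iff_positive measure_nonneg not_less_iff_gr_or_eq of_nat_0_less_iff order.antisym zero_less_Suc not_le)
    thus ?thesis by (subst (asm) N.prob_eq_0) (auto simp: not_less)
  qed
  hence "AE \<eta> in N. \<forall>n. \<bar>X \<eta>\<bar> \<le> inverse (real (Suc n))" by (simp add: AE_all_countable)
  hence X0: "AE \<eta> in N. X \<eta> = 0"
  proof eventually_elim
    case (elim \<eta>)
    show ?case
    proof (rule ccontr)
      assume "X \<eta> \<noteq> 0"
      then obtain n where "inverse (real (Suc n)) < \<bar>X \<eta>\<bar>"
        using reals_Archimedean[of "\<bar>X \<eta>\<bar>"] by auto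
      thus False using elim[rule_format, of n] by simp
    qed
  qed
  \<comment> \<open>If \<open>X\<close> is 0 almost surely, the equation in law tested at the point
    0 reduces to \<open>B = 0\<close> almost surely.\<close>
  have "1 = N.expectation (\<lambda>\<eta>. indicator {0::real} (X \<eta>) :: real)"
  proof -
    have "N.expectation (\<lambda>\<eta>. indicator {0::real} (X \<eta>) :: real) = N.expectation (\<lambda>_. 1)"
      using X0 by (intro integral_cong_AE) (auto elim!: eventually_mono)
    thus ?thesis by (simp add: N.prob_space)
  qed
  also have "\<dots> = expectation (\<lambda>\<omega>. N.expectation (\<lambda>\<eta>. indicator {0::real} (A \<omega> * X \<eta> + B \<omega>)))"
    by (rule solution_integral_fst[of _ 1]) (auto simp: indicator_def)
  also have "\<dots> = expectation (\<lambda>\<omega>. indicator {\<omega> \<in> space M. B \<omega> = 0} \<omega>)"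
  proof (rule Bochner_Integration.integral_cong)
    fix \<omega> assume w: "\<omega> \<in> space M"
    have "N.expectation (\<lambda>\<eta>. indicator {0::real} (A \<omega> * X \<eta> + B \<omega>)) =
        N.expectation (\<lambda>\<eta>. indicator {0} (B \<omega>) :: real)"
      using X0 by (intro integral_cong_AE) (auto elim!: eventually_mono)
    thus "N.expectation (\<lambda>\<eta>. indicator {0::real} (A \<omega> * X \<eta> + B \<omega>)) =
       (indicator {\<omega> \<in> space M. B \<omega> = 0} \<omega> :: real)"
      using w by (simp add: N.prob_space indicator_def)
  qed simp
  also have "\<dots> = prob {\<omega> \<in> space M. B \<omega> = 0}" by simp
  finally show False using assms by simp
qed

text \<open>On the two events |A X| exceeds 2 u while |B| is at most u, so |A X + B| > u. The
  probabilities multiply because \<open>X\<close> is independent of the coefficients.\<close>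

lemma one_big_jump:
  assumes u: "u > 0"
  shows "N.prob {\<eta> \<in> space N. \<bar>X \<eta>\<bar> > u} \<ge>
    prob {\<omega> \<in> space M. A \<omega> = exp (of_int k * h) \<and> \<bar>B \<omega>\<bar> \<le> u} *
    N.prob {\<eta> \<in> space N. \<bar>X \<eta>\<bar> > 2 * u * exp (- (of_int k * h))}"
    (is "_ \<ge> prob ?S * N.prob ?R")
proof -
  let ?f = "\<lambda>x::real. indicator {x. \<bar>x\<bar> > u} x :: real"
  have [measurable]: "{x::real. \<bar>x\<bar> > u} \<in> sets borel" by measurable
  have "prob ?S * N.prob ?R = expectation (\<lambda>\<omega>. indicator ?S \<omega> * N.prob ?R)"
    by simp
  also have "\<dots> \<le> expectation (\<lambda>\<omega>. N.expectation (\<lambda>\<eta>. ?f (A \<omega> * X \<eta> + B \<omega>)))"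
  proof (rule integral_mono)
    show "integrable M (\<lambda>\<omega>. indicator ?S \<omega> * N.prob ?R)"
      by (rule integrable_const_bound[of _ 1]) (auto simp: indicator_def)
    show "integrable M (\<lambda>\<omega>. N.expectation (\<lambda>\<eta>. ?f (A \<omega> * X \<eta> + B \<omega>)))"
      by (rule P.integrable_fst, rule integrable_pair[of _ 1]) (auto simp: indicator_def)
    fix \<omega> assume w: "\<omega> \<in> space M"
    show "indicator ?S \<omega> * N.prob ?R \<le> N.expectation (\<lambda>\<eta>. ?f (A \<omega> * X \<eta> + B \<omega>))"
    proof (cases "\<omega> \<in> ?S")
      case True
      have "N.prob ?R = N.expectation (\<lambda>\<eta>. indicator ?R \<eta>)" by simp
      also have "\<dots> \<le> N.expectation (\<lambda>\<eta>. ?f (A \<omega> * X \<eta> + B \<omega>))"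
      proof (rule integral_mono)
        show "integrable N (indicator ?R :: _ \<Rightarrow> real)"
          by (rule N.integrable_const_bound[of _ 1]) (auto simp: indicator_def)
        show "integrable N (\<lambda>\<eta>. ?f (A \<omega> * X \<eta> + B \<omega>))"
          by (rule N.integrable_const_bound[of _ 1]) (auto simp: indicator_def)
        fix \<eta>
        show "indicator ?R \<eta> \<le> ?f (A \<omega> * X \<eta> + B \<omega>)"
        proof (cases "\<eta> \<in> ?R")
          case R: True
          have "2 * u < A \<omega> * \<bar>X \<eta>\<bar>"
            using R True by (simp add: exp_minus field_simps)
          also have "A \<omega> * \<bar>X \<eta>\<bar> = \<bar>A \<omega> * X \<eta>\<bar>" using True by (simp add: abs_mult)
          finally have "u < \<bar>A \<omega> * X \<eta> + B \<omega>\<bar>" using True by auto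
          thus ?thesis by (simp add: indicator_def)
        qed (auto simp: indicator_def)
      qed
      finally show ?thesis using True by simp
    qed (auto intro!: Bochner_Integration.integral_nonneg)
  qed
  also have "\<dots> = N.expectation (\<lambda>\<eta>. ?f (X \<eta>))"
    by (rule solution_integral_fst[symmetric, of _ 1]) (auto simp: indicator_def)
  also have "\<dots> = N.expectation (\<lambda>\<eta>. indicator {\<eta> \<in> space N. \<bar>X \<eta>\<bar> > u} \<eta>)"
    by (rule Bochner_Integration.integral_cong) (auto simp: indicator_def)
  also have "\<dots> = N.prob {\<eta> \<in> space N. \<bar>X \<eta>\<bar> > u}" by simp
  finally show ?thesis .
qed

end

locale subexponential_perpetuity = lattice_perpetuity M A \<kappa> h \<theta> N B X \<nu> +
  subexponential_sequence "tilted_lattice.mass M A \<kappa> h \<theta>" C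
  for M :: "'a measure" and A \<kappa> h \<theta> and N :: "'b measure" and B X \<nu> C
begin

text \<open>Goldie's implicit renewal argument with the ramp instead of an indicator function, whose
  difference at \<open>A X + B\<close> and \<open>A X\<close> need not be small.\<close>

definition scaled_ramp :: "real \<Rightarrow> real \<Rightarrow> int \<Rightarrow> real" where
  "scaled_ramp a b n = exp (\<kappa> * of_int n * h) *
     N.expectation (\<lambda>\<eta>. ramp a b (X \<eta> * exp (- (of_int n * h))))"

lemma integrable_ramp:
  assumes "a < b" and [measurable]: "f \<in> borel_measurable N"
  shows "integrable N (\<lambda>\<eta>. ramp a b (f \<eta>))"
  by (rule N.integrable_const_bound[of _ "b - a"]) (use ramp_bounds[OF assms(1)] in auto)

lemma scaled_ramp_sandwich:
  assumes ab: "0 < a" "a < b"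
  shows "(b - a) * (exp (\<kappa> * of_int n * h) * N.prob {\<eta> \<in> space N. X \<eta> > b * exp (of_int n * h)}) \<le> scaled_ramp a b n"
    and "scaled_ramp a b n \<le> (b - a) * (exp (\<kappa> * of_int n * h) * N.prob {\<eta> \<in> space N. X \<eta> > a * exp (of_int n * h)})"
proof -
  let ?t = "exp (- (of_int n * h))"
  have ind: "(c::real) * N.prob {\<eta> \<in> space N. X \<eta> > x * exp (of_int n * h)} =
      N.expectation (\<lambda>\<eta>. c * indicator {x<..} (X \<eta> * ?t))"
    and int: "integrable N (\<lambda>\<eta>. c * indicator {x<..} (X \<eta> * ?t))" for c x
  proof -
    have eq: "N.expectation (\<lambda>\<eta>. c * indicator {x<..} (X \<eta> * ?t)) =
      N.expectation (\<lambda>\<eta>. c * indicator {\<eta> \<in> space N. X \<eta> > x * exp (of_int n * h)} \<eta>)"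
      by (rule Bochner_Integration.integral_cong) (auto simp: indicator_def exp_minus field_simps)
    show "c * N.prob {\<eta> \<in> space N. X \<eta> > x * exp (of_int n * h)} =
      N.expectation (\<lambda>\<eta>. c * indicator {x<..} (X \<eta> * ?t))"
      unfolding eq by simp
    show "integrable N (\<lambda>\<eta>. c * indicator {x<..} (X \<eta> * ?t))"
      by (rule N.integrable_const_bound[of _ "\<bar>c\<bar>"]) (auto simp: indicator_def)
  qed
  have "(b - a) * N.prob {\<eta> \<in> space N. X \<eta> > b * exp (of_int n * h)} \<le>
      N.expectation (\<lambda>\<eta>. ramp a b (X \<eta> * ?t))"
    unfolding ind by (intro integral_mono int integrable_ramp ab ramp_between) measurable
  from mult_left_mono[OF this, of "exp (\<kappa> * of_int n * h)"]
  show "(b - a) * (exp (\<kappa> * of_int n * h) * N.prob {\<eta> \<in> space N. X \<eta> > b * exp (of_int n * h)}) \<le> scaled_ramp a b n"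
    unfolding scaled_ramp_def by (simp add: mult_ac)
  have "N.expectation (\<lambda>\<eta>. ramp a b (X \<eta> * ?t)) \<le>
      (b - a) * N.prob {\<eta> \<in> space N. X \<eta> > a * exp (of_int n * h)}"
    unfolding ind by (intro integral_mono int integrable_ramp ab ramp_between) measurable
  from mult_left_mono[OF this, of "exp (\<kappa> * of_int n * h)"]
  show "scaled_ramp a b n \<le> (b - a) * (exp (\<kappa> * of_int n * h) * N.prob {\<eta> \<in> space N. X \<eta> > a * exp (of_int n * h)})"
    unfolding scaled_ramp_def by (simp add: mult_ac)
qed

lemma scaled_ramp_nonneg:
  assumes "a < b"
  shows "0 \<le> scaled_ramp a b n"
  unfolding scaled_ramp_def
  by (intro mult_nonneg_nonneg Bochner_Integration.integral_nonneg ramp_bounds assms) auto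

text \<open>The decay of order \<kappa> in \<open>tail_bound\<close> exactly cancels the factor
  \<open>exp (\<kappa> * n * h)\<close>, uniformly over all integers \<open>n\<close>.\<close>

lemma scaled_ramp_bounded:
  assumes ab: "0 < a" "a < b"
  shows "scaled_ramp a b n \<le> (b - a) * (tail_const * a powr (- \<kappa>))"
proof -
  have "scaled_ramp a b n \<le> (b - a) * (exp (\<kappa> * of_int n * h) * N.prob {\<eta> \<in> space N. X \<eta> > a * exp (of_int n * h)})"
    by (rule scaled_ramp_sandwich[OF ab])
  also have "\<dots> \<le> (b - a) * (exp (\<kappa> * of_int n * h) * (tail_const * (a * exp (of_int n * h)) powr (- \<kappa>)))"
  proof (intro mult_left_mono)
    have "N.prob {\<eta> \<in> space N. X \<eta> > a * exp (of_int n * h)} \<le> N.prob {\<eta> \<in> space N. \<bar>X \<eta>\<bar> > a * exp (of_int n * h)}"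
      by (intro N.finite_measure_mono) auto
    also have "\<dots> \<le> tail_const * (a * exp (of_int n * h)) powr (- \<kappa>)"
      using ab by (intro tail_bound) auto
    finally show "N.prob {\<eta> \<in> space N. X \<eta> > a * exp (of_int n * h)} \<le> tail_const * (a * exp (of_int n * h)) powr (- \<kappa>)" .
  qed (use ab in auto)
  also have "(a * exp (of_int n * h)) powr (- \<kappa>) = a powr (- \<kappa>) * exp (- (\<kappa> * of_int n * h))"
    by (simp add: powr_mult) (simp add: powr_def mult_ac)
  also have "exp (\<kappa> * of_int n * h) * (tail_const * (a powr (- \<kappa>) * exp (- (\<kappa> * of_int n * h)))) = tail_const * a powr (- \<kappa>)"
    by (simp add: exp_minus field_simps)
  finally show ?thesis .
qed

lemma scaled_ramp_low:
  assumes ab: "a < b"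
  shows "integrable (count_space UNIV) (\<lambda>j. indicator {..<m} j * scaled_ramp a b j)"
proof (rule Bochner_Integration.integrable_bound)
  show "integrable (count_space UNIV) (\<lambda>j. (b - a) * (indicator {..<m} j * exp (\<kappa> * h * of_int j)))"
    using \<kappa>_pos h_pos by (intro integrable_mult_right integrable_geometric_below) simp
  have "scaled_ramp a b j \<le> exp (\<kappa> * of_int j * h) * (b - a)" for j
  proof -
    have "N.expectation (\<lambda>\<eta>. ramp a b (X \<eta> * exp (- (of_int j * h)))) \<le> N.expectation (\<lambda>_. b - a)"
      by (intro integral_mono integrable_ramp ab ramp_bounds) auto
    thus ?thesis unfolding scaled_ramp_def by (intro mult_left_mono) (auto simp: N.prob_space)
  qed
  thus "AE j in count_space UNIV. norm (indicator {..<m} j * scaled_ramp a b j)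
     \<le> norm ((b - a) * (indicator {..<m} j * exp (\<kappa> * h * of_int j)))"
    using scaled_ramp_nonneg[OF ab] ab by (intro AE_I2) (auto simp: indicator_def mult_ac)
qed simp

definition perturbation :: "real \<Rightarrow> real \<Rightarrow> nat \<Rightarrow> real" where
  "perturbation a b n = exp (\<kappa> * n * h) *
     (\<integral>(\<omega>, \<eta>). ramp a b ((A \<omega> * X \<eta> + B \<omega>) * exp (- (n * h)))
        - ramp a b (A \<omega> * X \<eta> * exp (- (n * h))) \<partial>(M \<Otimes>\<^sub>M N))"

text \<open>Replacing \<open>A X + B\<close> by \<open>A X\<close> costs
  \<open>perturbation\<close>. If \<open>A\<close> equals \<open>exp (k * h)\<close>, the remaining
  inner expectation is \<open>A powr \<kappa>\<close> times the scaled ramp at \<open>n - k\<close>,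
  and the tilt converts the factor \<open>A powr \<kappa>\<close> into \<theta> times the
  masses.\<close>

lemma scaled_ramp_renewal:
  assumes ab: "0 < a" "a < b"
  shows "scaled_ramp a b (int n) = perturbation a b n +
    \<theta> * (\<integral>j. mass (int n - j) * scaled_ramp a b j \<partial>count_space UNIV)"
proof -
  let ?t = "exp (- (real n * h))" and ?g = "scaled_ramp a b"
  have bd: "\<bar>ramp a b y\<bar> \<le> b - a" for y using ramp_bounds[OF ab(2), of y] by simp
  have gb: "\<bar>?g k\<bar> \<le> (b - a) * (tail_const * a powr (- \<kappa>))" for k
    using scaled_ramp_nonneg[OF ab(2), of k] scaled_ramp_bounded[OF ab, of k] by simp
  have i1: "integrable (M \<Otimes>\<^sub>M N) (\<lambda>(\<omega>, \<eta>). ramp a b ((A \<omega> * X \<eta> + B \<omega>) * ?t))"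
    by (rule integrable_pair[of _ "b - a"]) (auto simp: bd)
  have i2: "integrable (M \<Otimes>\<^sub>M N) (\<lambda>(\<omega>, \<eta>). ramp a b (A \<omega> * X \<eta> * ?t))"
    by (rule integrable_pair[of _ "b - a"]) (auto simp: bd)
  have "?g (int n) = exp (\<kappa> * n * h) * (\<integral>(\<omega>, \<eta>). ramp a b ((A \<omega> * X \<eta> + B \<omega>) * ?t) \<partial>(M \<Otimes>\<^sub>M N))"
    unfolding scaled_ramp_def
    using solution_integral(1)[of "\<lambda>x. ramp a b (x * ?t)" "b - a"] bd by simp
  moreover have "(\<integral>(\<omega>, \<eta>). ramp a b ((A \<omega> * X \<eta> + B \<omega>) * ?t) - ramp a b (A \<omega> * X \<eta> * ?t) \<partial>(M \<Otimes>\<^sub>M N)) =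
    (\<integral>(\<omega>, \<eta>). ramp a b ((A \<omega> * X \<eta> + B \<omega>) * ?t) \<partial>(M \<Otimes>\<^sub>M N)) -
    (\<integral>(\<omega>, \<eta>). ramp a b (A \<omega> * X \<eta> * ?t) \<partial>(M \<Otimes>\<^sub>M N))"
    using Bochner_Integration.integral_diff[OF i1 i2] by (simp add: case_prod_unfold)
  ultimately have 1: "?g (int n) = perturbation a b n +
     exp (\<kappa> * n * h) * (\<integral>(\<omega>, \<eta>). ramp a b (A \<omega> * X \<eta> * ?t) \<partial>(M \<Otimes>\<^sub>M N))"
    unfolding perturbation_def by (simp only: right_diff_distrib diff_add_cancel)
  have "exp (\<kappa> * n * h) * (\<integral>(\<omega>, \<eta>). ramp a b (A \<omega> * X \<eta> * ?t) \<partial>(M \<Otimes>\<^sub>M N)) =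
     expectation (\<lambda>\<omega>. exp (\<kappa> * n * h) * N.expectation (\<lambda>\<eta>. ramp a b (A \<omega> * X \<eta> * ?t)))"
    using P.integral_fst[OF i2] by simp
  also have "\<dots> = expectation (\<lambda>\<omega>. A \<omega> powr \<kappa> * ?g (int n - log_index \<omega>))"
  proof (rule integral_cong_AE)
    show "AE \<omega> in M. exp (\<kappa> * n * h) * N.expectation (\<lambda>\<eta>. ramp a b (A \<omega> * X \<eta> * ?t)) =
      A \<omega> powr \<kappa> * ?g (int n - log_index \<omega>)"
      using A_lattice
    proof eventually_elim
      case (elim \<omega>)
      show ?case
      proof (cases "A \<omega> = 0")
        case True
        \<comment> \<open>Both sides are 0: the ramp vanishes at 0 because \<open>a > 0\<close>, and
          \<open>0 powr \<kappa> = 0\<close>.\<close>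
        thus ?thesis using ab by (simp add: ramp_def)
      next
        case False
        then obtain k :: int where k: "A \<omega> = exp (of_int k * h)" using elim by auto
        have "N.expectation (\<lambda>\<eta>. ramp a b (A \<omega> * X \<eta> * ?t)) =
           N.expectation (\<lambda>\<eta>. ramp a b (X \<eta> * exp (- (of_int (int n - k) * h))))"
        proof (rule Bochner_Integration.integral_cong)
          fix \<eta>
          have "A \<omega> * ?t = exp (- (of_int (int n - k) * h))"
            unfolding k mult_exp_exp by (simp add: algebra_simps)
          moreover have "A \<omega> * X \<eta> * ?t = X \<eta> * (A \<omega> * ?t)" by simp
          ultimately show "ramp a b (A \<omega> * X \<eta> * ?t) = ramp a b (X \<eta> * exp (- (of_int (int n - k) * h)))"
            by (simp only:)
        qed simp
        moreover have "A \<omega> powr \<kappa> * exp (\<kappa> * of_int (int n - k) * h) = exp (\<kappa> * n * h)"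
          unfolding k by (simp add: powr_def mult_exp_exp algebra_simps)
        ultimately show ?thesis
          unfolding scaled_ramp_def log_index_exp[OF k] by (simp add: mult.assoc[symmetric])
      qed
    qed
  qed measurable
  also have "\<dots> = \<theta> * (\<integral>\<omega>. ?g (int n - log_index \<omega>) \<partial>tilted)"
    by (rule integral_tilted) measurable
  also have "(\<integral>\<omega>. ?g (int n - log_index \<omega>) \<partial>tilted) = (\<integral>k. mass k * ?g (int n - k) \<partial>count_space UNIV)"
    by (rule expectation_mass(1)[OF gb])
  also have "\<dots> = (\<integral>j. mass (int n - j) * ?g j \<partial>count_space UNIV)"
  proof -
    have b: "bij_betw (\<lambda>j. int n - j) UNIV (UNIV :: int set)"
      by (rule bij_betwI[where g = "\<lambda>j. int n - j"]) auto
    show ?thesis using integral_bij_count_space[OF b, of "\<lambda>k. mass k * ?g (int n - k)"] by simp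
  qed
  finally show ?thesis using 1 by simp
qed

lemma perturbation_negligible:
  assumes ab: "0 < a" "a < b"
  shows "(\<lambda>n. perturbation a b n / mass (int n)) \<longlonglongrightarrow> 0"
proof -
  have \<nu>_pos: "\<nu> > 0" using \<kappa>_pos \<nu>_greater by simp
  \<comment> \<open>The cut for |B| will be \<open>L = exp (s * n * h)\<close>. The lower bound on
    \<open>s\<close> makes the contribution of |B| > L decay like \<open>r1 ^ n\<close>, and
    \<open>s < 1\<close> makes the Lipschitz contribution decay like \<open>r2 ^ n\<close>.\<close>
  obtain s where s: "\<kappa> / \<nu> < s" "s < 1"
    using dense[of "\<kappa> / \<nu>" 1] \<nu>_greater \<nu>_pos by auto
  hence s\<nu>: "\<kappa> < s * \<nu>" using \<nu>_pos by (simp add: field_simps)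
  define r1 where "r1 = exp ((\<kappa> - s * \<nu>) * h)"
  define r2 where "r2 = exp ((s - 1) * h)"
  have r: "0 < r1" "r1 < 1" "0 < r2" "r2 < 1"
    using s s\<nu> h_pos by (auto simp: r1_def r2_def mult_neg_pos)
  define C1 where "C1 = (b - a) * expectation (\<lambda>\<omega>. \<bar>B \<omega>\<bar> powr \<nu>)"
  define C2 where "C2 = \<theta> * tail_const * (a / 2) powr (- \<kappa>)"
  have bound: "\<bar>perturbation a b n\<bar> \<le> C1 * r1 ^ n + C2 * r2 ^ n" if n: "r2 ^ n \<le> a / 2" for n
  proof -
    define L where "L = exp (s * n * h)"
    define t where "t = exp (- (n * h))"
    have pow: "exp x ^ n = exp (n * x)" for x :: real by (simp add: exp_of_nat_mult)
    have Lt: "L * t = r2 ^ n"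
      unfolding L_def t_def r2_def pow mult_exp_exp by (simp add: algebra_simps)
    have "\<bar>\<integral>(\<omega>, \<eta>). ramp a b ((A \<omega> * X \<eta> + B \<omega>) * t) - ramp a b (A \<omega> * X \<eta> * t) \<partial>(M \<Otimes>\<^sub>M N)\<bar> \<le>
      C1 * L powr (- \<nu>) + L * t * (\<theta> * tail_const * (a / 2 / t) powr (- \<kappa>))"
      unfolding C1_def by (rule ramp_difference_bound) (use ab n Lt in \<open>auto simp: L_def t_def\<close>)
    hence "\<bar>perturbation a b n\<bar> \<le> exp (\<kappa> * n * h) *
       (C1 * L powr (- \<nu>) + L * t * (\<theta> * tail_const * (a / 2 / t) powr (- \<kappa>)))"
      unfolding perturbation_def t_def[symmetric] abs_mult by simp
    also have "\<dots> = C1 * (exp (\<kappa> * n * h) * L powr (- \<nu>)) +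
       C2 * (L * t) * (exp (\<kappa> * n * h) * (1 / t) powr (- \<kappa>))"
      unfolding C2_def using powr_mult[of "a / 2" "1 / t" "- \<kappa>"] by (simp add: algebra_simps)
    also have "exp (\<kappa> * n * h) * L powr (- \<nu>) = r1 ^ n"
      unfolding L_def r1_def pow by (simp add: powr_def mult_exp_exp algebra_simps)
    also have "exp (\<kappa> * n * h) * (1 / t) powr (- \<kappa>) = 1"
    proof -
      have "1 / t = exp (n * h)" by (simp add: t_def exp_minus divide_inverse)
      thus ?thesis by (simp add: powr_def mult_exp_exp)
    qed
    finally show ?thesis by (simp add: Lt)
  qed
  have "(\<lambda>n. C1 * (r1 ^ n / mass (int n)) + C2 * (r2 ^ n / mass (int n))) \<longlonglongrightarrow> C1 * 0 + C2 * 0"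
    using r by (intro tendsto_intros geometric_negligible) auto
  hence lim: "(\<lambda>n. C1 * (r1 ^ n / mass (int n)) + C2 * (r2 ^ n / mass (int n))) \<longlonglongrightarrow> 0" by simp
  have "(\<lambda>n. r2 ^ n) \<longlonglongrightarrow> 0" using r by (intro LIMSEQ_power_zero) auto
  hence "\<forall>\<^sub>F n in sequentially. r2 ^ n < a / 2" by (rule order_tendstoD) (use ab in auto)
  hence "\<forall>\<^sub>F n in sequentially. norm (perturbation a b n / mass (int n)) \<le>
     C1 * (r1 ^ n / mass (int n)) + C2 * (r2 ^ n / mass (int n))"
  proof eventually_elim
    case (elim n)
    have "\<bar>perturbation a b n\<bar> / mass (int n) \<le> (C1 * r1 ^ n + C2 * r2 ^ n) / mass (int n)"
      by (rule divide_right_mono) (use bound elim mass_nonneg in auto)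
    thus ?case by (simp add: abs_divide mass_nonneg add_divide_distrib)
  qed
  thus ?thesis by (rule Lim_null_comparison[OF _ lim])
qed

lemma scaled_ramp_limit:
  assumes ab: "0 < a" "a < b"
  shows "\<exists>l. (\<lambda>n. scaled_ramp a b (int n) / mass (int n)) \<longlonglongrightarrow> l"
  using renewal_limit[OF \<theta>_pos \<theta>_less scaled_ramp_nonneg[OF ab(2)] scaled_ramp_bounded[OF ab]
     scaled_ramp_low[OF ab(2)] perturbation_negligible[OF ab] scaled_ramp_renewal[OF ab]] .

section \<open>Normalized tails: comparison with ramps, monotonicity, shift\<close>

definition tail_ratio :: "nat \<Rightarrow> real \<Rightarrow> real" where
  "tail_ratio n x = inverse (mass (int n)) * exp (\<kappa> * n * h) *
     N.prob {\<eta> \<in> space N. X \<eta> > x * exp (n * h)}"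

lemma tail_ratio_nonneg: "tail_ratio n x \<ge> 0"
  by (simp add: tail_ratio_def mass_nonneg)

text \<open>\<open>R\<close> is the scaled ramp over the mass, divided by the height
  \<open>b - a\<close>; it converges by \<open>scaled_ramp_limit\<close>.\<close>

lemma tail_ratio_squeeze:
  assumes ab: "0 < a" "a < b"
  shows "\<exists>R l. R \<longlonglongrightarrow> l \<and> (\<forall>n. tail_ratio n b \<le> R n \<and> R n \<le> tail_ratio n a)"
proof -
  obtain l where l: "(\<lambda>n. scaled_ramp a b (int n) / mass (int n)) \<longlonglongrightarrow> l"
    using scaled_ramp_limit[OF ab] by blast
  define R where "R n = scaled_ramp a b (int n) / mass (int n) / (b - a)" for n
  have "R \<longlonglongrightarrow> l / (b - a)" unfolding R_def using ab by (intro tendsto_intros l) auto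
  moreover have "tail_ratio n b \<le> R n \<and> R n \<le> tail_ratio n a" for n
  proof -
    have m: "inverse (mass (int n)) \<ge> 0" by (simp add: mass_nonneg)
    define y where "y = scaled_ramp a b (int n) / mass (int n)"
    from mult_left_mono[OF scaled_ramp_sandwich(1)[OF ab, of "int n"] m]
      mult_left_mono[OF scaled_ramp_sandwich(2)[OF ab, of "int n"] m]
    have "(b - a) * tail_ratio n b \<le> y" "y \<le> (b - a) * tail_ratio n a"
      unfolding tail_ratio_def y_def by (simp_all add: divide_inverse mult_ac)
    thus ?thesis unfolding R_def y_def[symmetric] using ab by (simp add: pos_le_divide_eq pos_divide_le_eq mult.commute)
  qed
  ultimately show ?thesis by blast
qed

lemma tail_ratio_antimono:
  assumes "x \<le> y"
  shows "tail_ratio n y \<le> tail_ratio n x"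
  unfolding tail_ratio_def
proof (intro mult_left_mono N.finite_measure_mono)
  have "x * exp (n * h) \<le> y * exp (n * h)" using assms by simp
  thus "{\<eta> \<in> space N. y * exp (n * h) < X \<eta>} \<subseteq> {\<eta> \<in> space N. x * exp (n * h) < X \<eta>}"
    by (blast intro: order.strict_trans1)
qed (auto simp: mass_nonneg)

text \<open>The threshold \<open>x * exp h\<close> at stage \<open>n\<close> is the threshold
  \<open>x\<close> at stage \<open>n + 1\<close>; only the normalizations differ.\<close>

lemma tail_ratio_shift:
  assumes "mass (int (Suc n)) > 0"
  shows "tail_ratio n (x * exp h) = mass (int (Suc n)) / mass (int n) * exp (- (\<kappa> * h)) * tail_ratio (Suc n) x"
proof -
  have "exp h * exp (n * h) = exp (Suc n * h)"
    by (simp add: mult_exp_exp algebra_simps)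
  hence "x * exp h * exp (n * h) = x * exp (Suc n * h)" by (simp only: mult.assoc)
  moreover have "exp (\<kappa> * n * h) = exp (- (\<kappa> * h)) * exp (\<kappa> * Suc n * h)"
    by (simp add: mult_exp_exp algebra_simps)
  moreover have "inverse m * (u * v) * w = m' / m * u * (inverse m' * v * w)" if "m' > 0"
    for m m' u v w :: real
    using that by (simp add: field_simps)
  ultimately show ?thesis
    unfolding tail_ratio_def using assms by (simp only:)
qed

end

subsection \<open>Limits of the tails\<close>

text \<open>The convergent majorant keeps the upper limit finite, so that
  \<open>real_of_ereal\<close> loses nothing.\<close>

lemma limsup_real:
  fixes f :: "nat \<Rightarrow> real"
  assumes "\<And>n. 0 \<le> f n" "\<And>n. f n \<le> R n" "R \<longlonglongrightarrow> l"
  shows "ereal (real_of_ereal (limsup (\<lambda>n. ereal (f n)))) = limsup (\<lambda>n. ereal (f n))"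
    and "0 \<le> real_of_ereal (limsup (\<lambda>n. ereal (f n)))"
    and "real_of_ereal (limsup (\<lambda>n. ereal (f n))) \<le> l"
proof -
  let ?L = "limsup (\<lambda>n. ereal (f n))"
  have "?L \<le> limsup (\<lambda>n. ereal (R n))" by (intro Limsup_mono) (auto simp: assms)
  also have "\<dots> = ereal l" by (intro lim_imp_Limsup) (auto simp: assms)
  finally have up: "?L \<le> ereal l" .
  have "ereal 0 \<le> ?L" by (rule le_Limsup) (auto simp: assms)
  thus "ereal (real_of_ereal ?L) = ?L" "0 \<le> real_of_ereal ?L" "real_of_ereal ?L \<le> l"
    using up by (cases ?L; simp)+
qed

text \<open>\<open>R\<close> is meant to be the sequence of averages of \<open>T n\<close> over the interval from \<open>a\<close> to \<open>b\<close>.\<close>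

lemma tendsto_limsup_at_continuity_point:
  fixes T :: "nat \<Rightarrow> real \<Rightarrow> real"
  assumes nonneg: "\<And>n x. T n x \<ge> 0"
    and squeeze: "\<And>a b. 0 < a \<Longrightarrow> a < b \<Longrightarrow> \<exists>R l. R \<longlonglongrightarrow> l \<and> (\<forall>n. T n b \<le> R n \<and> R n \<le> T n a)"
  defines "\<tau> \<equiv> \<lambda>x. real_of_ereal (limsup (\<lambda>n. ereal (T n x)))"
  assumes x: "x > 0" "isCont \<tau> x"
  shows "(\<lambda>n. T n x) \<longlonglongrightarrow> \<tau> x"
proof (rule order_tendstoI)
  fix u assume u: "u < \<tau> x"
  \<comment> \<open>Lower bound: by continuity some \<open>b > x\<close> still has
    \<open>u < \<tau> b\<close>, and \<tau> b is at most the limit of the averages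
    \<open>R n\<close>, which lie below \<open>T n x\<close>.\<close>
  have "\<forall>\<^sub>F b in at_right x. u < \<tau> b"
    using x(2) u by (intro order_tendstoD(1)[of \<tau> "\<tau> x"]) (auto simp: isCont_def filterlim_at_split)
  then obtain b where b: "b > x" "u < \<tau> b"
    using eventually_at_right_field[of _ x] dense by (metis (no_types, lifting) lt_ex)
  obtain R l where R: "R \<longlonglongrightarrow> l" "\<And>n. T n b \<le> R n" "\<And>n. R n \<le> T n x"
    using squeeze[OF x(1) b(1)] by blast
  have "\<tau> b \<le> l" unfolding \<tau>_def by (rule limsup_real(3)[OF nonneg R(2,1)])
  hence "\<forall>\<^sub>F n in sequentially. u < R n" using b by (intro order_tendstoD(1)[OF R(1)]) auto
  thus "\<forall>\<^sub>F n in sequentially. u < T n x" by eventually_elim (use R(3) less_le_trans in blast)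
next
  fix u assume u: "\<tau> x < u"
  \<comment> \<open>The upper bound is the definition of the upper limit; the squeeze from
    \<open>x / 2\<close> serves to show that it is finite.\<close>
  have "x / 2 < x" "0 < x / 2" using x by auto
  then obtain R l where R: "R \<longlonglongrightarrow> l" "\<And>n. T n x \<le> R n"
    using squeeze[of "x / 2" x] by blast
  have "limsup (\<lambda>n. ereal (T n x)) = ereal (\<tau> x)"
    unfolding \<tau>_def by (rule limsup_real(1)[OF nonneg R(2,1), symmetric])
  also have "\<dots> < ereal u" using u by simp
  finally have "\<forall>\<^sub>F n in sequentially. ereal (T n x) < ereal u" by (rule Limsup_lessD)
  thus "\<forall>\<^sub>F n in sequentially. T n x < u" by simp
qed

context subexponential_perpetuity
begin

text \<open>An upper limit exists at every \<open>x\<close> and inherits monotonicity, whereas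
  convergence is obtained only at continuity points.\<close>

definition tail_limsup :: "real \<Rightarrow> real" where
  "tail_limsup x = real_of_ereal (limsup (\<lambda>n. ereal (tail_ratio n x)))"

definition tail_profile :: "real \<Rightarrow> real" where
  "tail_profile x = x powr \<kappa> * tail_limsup x"

lemma tail_limsup:
  assumes "x > 0"
  shows "ereal (tail_limsup x) = limsup (\<lambda>n. ereal (tail_ratio n x))" "0 \<le> tail_limsup x"
proof -
  have "x / 2 < x" "0 < x / 2" using assms by auto
  then obtain R l where R: "R \<longlonglongrightarrow> l" "\<And>n. tail_ratio n x \<le> R n"
    using tail_ratio_squeeze[of "x / 2" x] by blast
  show "ereal (tail_limsup x) = limsup (\<lambda>n. ereal (tail_ratio n x))" "0 \<le> tail_limsup x"
    unfolding tail_limsup_def using limsup_real[OF tail_ratio_nonneg R(2,1)] by auto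
qed

lemma tail_limsup_antimono:
  assumes "0 < x" "x \<le> y"
  shows "tail_limsup y \<le> tail_limsup x"
proof -
  have "ereal (tail_limsup y) \<le> ereal (tail_limsup x)"
    using assms by (subst (1 2) tail_limsup) (auto intro!: Limsup_mono always_eventually tail_ratio_antimono)
  thus ?thesis by simp
qed

text \<open>By \<open>tail_ratio_shift\<close> the two sequences differ by a shift of the index and
  a factor that converges because the ratios of masses tend to 1; upper limits respect both.\<close>

lemma tail_limsup_shift:
  assumes x: "x > 0"
  shows "tail_limsup (x * exp h) = exp (- (\<kappa> * h)) * tail_limsup x"
proof -
  define c where "c n = mass (int (Suc n)) / mass (int n) * exp (- (\<kappa> * h))" for n
  have "c \<longlonglongrightarrow> 1 * exp (- (\<kappa> * h))"
    unfolding c_def using p_ratio by (intro tendsto_intros) simp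
  hence c: "(\<lambda>n. ereal (c n)) \<longlonglongrightarrow> ereal (exp (- (\<kappa> * h)))" by simp
  have "\<forall>\<^sub>F n in sequentially. mass (int (Suc n)) > 0"
    using p_pos by (subst eventually_sequentially_Suc)
  hence "\<forall>\<^sub>F n in sequentially. ereal (tail_ratio n (x * exp h)) = ereal (c n) * ereal (tail_ratio (n + 1) x)"
    by eventually_elim (simp add: tail_ratio_shift c_def)
  hence "limsup (\<lambda>n. ereal (tail_ratio n (x * exp h))) =
     limsup (\<lambda>n. ereal (c n) * ereal (tail_ratio (n + 1) x))"
    by (rule Limsup_eq)
  also have "\<dots> = ereal (exp (- (\<kappa> * h))) * limsup (\<lambda>n. ereal (tail_ratio (n + 1) x))"
    by (rule ereal_limsup_lim_mult[OF c]) auto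
  also have "limsup (\<lambda>n. ereal (tail_ratio (n + 1) x)) = limsup (\<lambda>n. ereal (tail_ratio n x))"
    by (rule limsup_shift)
  finally have "ereal (tail_limsup (x * exp h)) = ereal (exp (- (\<kappa> * h))) * ereal (tail_limsup x)"
    using x by (simp add: tail_limsup)
  thus ?thesis by simp
qed

lemma tail_profile_Q_class: "tail_profile \<in> Q_class \<kappa> h"
proof -
  have "antimono_on {0<..} (\<lambda>x. x powr (- \<kappa>) * tail_profile x)"
  proof (rule monotone_onI)
    fix x y :: real assume *: "x \<in> {0<..}" "y \<in> {0<..}" "x \<le> y"
    have "z powr (- \<kappa>) * tail_profile z = tail_limsup z" if "z > 0" for z
      using that by (simp add: tail_profile_def powr_minus field_simps)
    thus "x powr (- \<kappa>) * tail_profile x \<ge> y powr (- \<kappa>) * tail_profile y"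
      using * tail_limsup_antimono[of x y] by simp
  qed
  moreover have "tail_profile (x * exp h) = tail_profile x" if "x > 0" for x
  proof -
    have "(x * exp h) powr \<kappa> * exp (- (\<kappa> * h)) = x powr \<kappa>"
      unfolding powr_mult by (simp add: powr_def[of "exp h"] exp_minus)
    thus ?thesis
      unfolding tail_profile_def tail_limsup_shift[OF that] by (simp add: mult.assoc[symmetric])
  qed
  ultimately show ?thesis
    unfolding Q_class_def by (auto simp: tail_profile_def tail_limsup)
qed

lemma tail_profile_limit:
  assumes "x \<in> continuity_points tail_profile"
  shows "(\<lambda>n. x powr \<kappa> * tail_ratio n x) \<longlonglongrightarrow> tail_profile x"
proof -
  have x: "x > 0" "isCont tail_profile x" using assms by (auto simp: continuity_points_def)
  \<comment> \<open>Continuity passes from the profile to the upper limit, since near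
    \<open>x > 0\<close> the two differ by a continuous factor.\<close>
  have "isCont (\<lambda>y. y powr (- \<kappa>) * tail_profile y) x"
    using x by (intro continuous_intros) auto
  also have "isCont (\<lambda>y. y powr (- \<kappa>) * tail_profile y) x \<longleftrightarrow> isCont tail_limsup x"
  proof (rule isCont_cong)
    have "\<forall>\<^sub>F y in nhds x. y > 0" using x by (intro order_tendstoD(1)[OF filterlim_ident])
    thus "\<forall>\<^sub>F y in nhds x. y powr (- \<kappa>) * tail_profile y = tail_limsup y"
      by eventually_elim (simp add: tail_profile_def powr_minus field_simps)
  qed
  finally have "(\<lambda>n. tail_ratio n x) \<longlonglongrightarrow> tail_limsup x"
    using x unfolding tail_limsup_def[abs_def]
    by (intro tendsto_limsup_at_continuity_point tail_ratio_nonneg tail_ratio_squeeze)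
  thus ?thesis unfolding tail_profile_def by (intro tendsto_intros)
qed

text \<open>Let \<open>A\<close> jump to \<open>exp ((n + j) * h)\<close> with \<open>j\<close>
  fixed. By \<open>mass_eq\<close> this has probability of order
  \<open>mass n * exp (- \<kappa> * n * h)\<close>, while a large \<open>B\<close> costs only order
  \<open>exp (- \<nu> * n * h)\<close>, negligible since \<nu> > \<kappa>.\<close>

lemma absolute_tail_lower_bound:
  assumes B: "prob {\<omega> \<in> space M. B \<omega> = 0} < 1" and x: "x > 0"
  shows "\<exists>c>0. \<forall>\<^sub>F n in sequentially. c \<le> inverse (mass (int n)) * exp (\<kappa> * real n * h) *
     N.prob {\<eta> \<in> space N. \<bar>X \<eta>\<bar> > x * exp (real n * h)}"
proof -
  obtain y where y: "y > 0" "N.prob {\<eta> \<in> space N. \<bar>X \<eta>\<bar> > y} > 0"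
    using solution_nonzero[OF B] by blast
  \<comment> \<open>A large \<open>j\<close> lowers the level required of |X| to \<open>y\<close>,
    which |X| exceeds with positive probability.\<close>
  obtain j :: nat where j: "2 * x * exp (- (j * h)) \<le> y"
  proof -
    have "(\<lambda>j. 2 * x * exp (- h) ^ j) \<longlonglongrightarrow> 2 * x * 0"
      using h_pos by (intro tendsto_intros LIMSEQ_power_zero) auto
    hence "\<forall>\<^sub>F j in sequentially. 2 * x * exp (- h) ^ j < y"
      by (rule order_tendstoD) (use y in simp)
    then obtain j where "2 * x * exp (- h) ^ j < y" unfolding eventually_sequentially by blast
    thus ?thesis by (intro that[of j]) (simp add: exp_of_nat_mult[symmetric])
  qed
  define \<pi> where "\<pi> = N.prob {\<eta> \<in> space N. \<bar>X \<eta>\<bar> > 2 * x * exp (- (j * h))}"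
  have "N.prob {\<eta> \<in> space N. \<bar>X \<eta>\<bar> > y} \<le> \<pi>"
    unfolding \<pi>_def using j by (intro N.finite_measure_mono) auto
  hence \<pi>: "\<pi> > 0" using y by simp
  define b where "b = expectation (\<lambda>\<omega>. \<bar>B \<omega>\<bar> powr \<nu>) * x powr (- \<nu>)"
  define r where "r = exp ((\<kappa> - \<nu>) * h)"
  have r: "0 < r" "r < 1" using \<nu>_greater h_pos by (auto simp: r_def mult_neg_pos)
  define f where "f n = \<pi> * (\<theta> * exp (- (\<kappa> * j * h)) * (mass (int n + int j) / mass (int n)) - b * (r ^ n / mass (int n)))" for n
  have "f \<longlonglongrightarrow> \<pi> * (\<theta> * exp (- (\<kappa> * j * h)) * 1 - b * 0)"
    unfolding f_def using r by (intro tendsto_intros p_shift geometric_negligible)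
  \<comment> \<open>Half of the positive limit of \<open>f\<close>.\<close>
  moreover define c where "c = \<pi> * (\<theta> * exp (- (\<kappa> * j * h))) / 2"
  have c: "c > 0" using \<pi> \<theta>_pos by (simp add: c_def)
  ultimately have "\<forall>\<^sub>F n in sequentially. c < f n"
    by (intro order_tendstoD(1)) (auto simp: c_def)
  moreover have "f n \<le> inverse (mass (int n)) * exp (\<kappa> * real n * h) *
     N.prob {\<eta> \<in> space N. \<bar>X \<eta>\<bar> > x * exp (real n * h)}" for n
  proof -
    define u where "u = x * exp (n * h)"
    have u: "u > 0" using x by (simp add: u_def)
    define k where "k = int n + int j"
    let ?A = "{\<omega> \<in> space M. A \<omega> = exp (of_int k * h)}" and ?B = "{\<omega> \<in> space M. \<bar>B \<omega>\<bar> > u}"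
    have uk: "2 * u * exp (- (of_int k * h)) = 2 * x * exp (- (j * h))"
    proof -
      have "exp (n * h) * exp (- (of_int k * h)) = exp (- (j * h))"
        unfolding k_def mult_exp_exp by (simp add: algebra_simps)
      thus ?thesis unfolding u_def by (simp only: mult.assoc)
    qed
    have "prob ?A \<le> prob ({\<omega> \<in> space M. A \<omega> = exp (of_int k * h) \<and> \<bar>B \<omega>\<bar> \<le> u} \<union> ?B)"
      by (intro finite_measure_mono) auto
    also have "\<dots> \<le> prob {\<omega> \<in> space M. A \<omega> = exp (of_int k * h) \<and> \<bar>B \<omega>\<bar> \<le> u} + prob ?B"
      by (rule measure_Un_le) auto
    also have "prob ?B \<le> expectation (\<lambda>\<omega>. \<bar>B \<omega>\<bar> powr \<nu>) * u powr (- \<nu>)"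
      by (rule B_tail_bound[OF u])
    finally have pA: "prob ?A - expectation (\<lambda>\<omega>. \<bar>B \<omega>\<bar> powr \<nu>) * u powr (- \<nu>) \<le>
       prob {\<omega> \<in> space M. A \<omega> = exp (of_int k * h) \<and> \<bar>B \<omega>\<bar> \<le> u}" by simp
    have "(prob ?A - expectation (\<lambda>\<omega>. \<bar>B \<omega>\<bar> powr \<nu>) * u powr (- \<nu>)) * \<pi> \<le>
      N.prob {\<eta> \<in> space N. \<bar>X \<eta>\<bar> > u}"
      using order_trans[OF mult_right_mono[OF pA] one_big_jump[OF u, of k]] \<pi>
      unfolding uk \<pi>_def[symmetric] by simp
    hence le: "exp (\<kappa> * n * h) * ((prob ?A - expectation (\<lambda>\<omega>. \<bar>B \<omega>\<bar> powr \<nu>) * u powr (- \<nu>)) * \<pi>) \<le>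
      exp (\<kappa> * n * h) * N.prob {\<eta> \<in> space N. \<bar>X \<eta>\<bar> > u}" by (intro mult_left_mono) auto
    have e1: "exp (\<kappa> * n * h) * prob ?A = \<theta> * exp (- (\<kappa> * j * h)) * mass k"
    proof -
      have "\<theta> * exp (- (\<kappa> * j * h)) * mass k = exp (- (\<kappa> * j * h)) * (\<theta> * mass k)" by simp
      also have "\<dots> = exp (- (\<kappa> * j * h)) * exp (\<kappa> * of_int k * h) * prob ?A"
        unfolding mass_eq by simp
      also have "exp (- (\<kappa> * j * h)) * exp (\<kappa> * of_int k * h) = exp (\<kappa> * n * h)"
        unfolding k_def mult_exp_exp by (simp add: algebra_simps)
      finally show ?thesis by simp
    qed
    have e2: "exp (\<kappa> * n * h) * u powr (- \<nu>) = x powr (- \<nu>) * r ^ n"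
    proof -
      have "u powr (- \<nu>) = x powr (- \<nu>) * exp (- (\<nu> * n * h))"
        unfolding u_def powr_mult by (simp add: powr_def[of "exp _"] mult_ac)
      moreover have "exp (\<kappa> * n * h) * exp (- (\<nu> * n * h)) = r ^ n"
        unfolding r_def exp_of_nat_mult[symmetric] mult_exp_exp by (simp add: algebra_simps)
      ultimately show ?thesis by simp
    qed
    have eq: "\<pi> * (\<theta> * exp (- (\<kappa> * j * h)) * mass k - b * r ^ n) =
      exp (\<kappa> * n * h) * ((prob ?A - expectation (\<lambda>\<omega>. \<bar>B \<omega>\<bar> powr \<nu>) * u powr (- \<nu>)) * \<pi>)"
      unfolding b_def e1[symmetric] using e2 by (simp add: algebra_simps)
    have "inverse (mass (int n)) * (\<pi> * (\<theta> * exp (- (\<kappa> * j * h)) * mass k - b * r ^ n)) \<le>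
      inverse (mass (int n)) * (exp (\<kappa> * n * h) * N.prob {\<eta> \<in> space N. \<bar>X \<eta>\<bar> > u})"
      unfolding eq by (intro mult_left_mono[OF le]) (simp add: mass_nonneg)
    thus ?thesis unfolding f_def u_def k_def by (simp add: algebra_simps divide_inverse)
  qed
  ultimately have "\<forall>\<^sub>F n in sequentially. c \<le> inverse (mass (int n)) * exp (\<kappa> * real n * h) *
     N.prob {\<eta> \<in> space N. \<bar>X \<eta>\<bar> > x * exp (real n * h)}"
    by (auto elim!: eventually_mono intro: order_trans less_imp_le)
  thus ?thesis using c by blast
qed

text \<open>A nonnegative sequence with upper limit 0 converges, so this holds at every
  \<open>x > 0\<close>, whether or not it is a continuity point.\<close>

lemma tail_ratio_tendsto_0:
  assumes "x > 0" "tail_profile x = 0"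
  shows "(\<lambda>n. tail_ratio n x) \<longlonglongrightarrow> 0"
proof -
  have "limsup (\<lambda>n. ereal (tail_ratio n x)) = 0"
    using assms tail_limsup(1)[of x] by (simp add: tail_profile_def zero_ereal_def)
  hence lt: "\<forall>\<^sub>F n in sequentially. ereal (tail_ratio n x) < ereal u" if "0 < u" for u
    using that by (intro Limsup_lessD) simp
  show ?thesis
  proof (rule order_tendstoI)
    show "\<forall>\<^sub>F n in sequentially. u < tail_ratio n x" if "u < 0" for u
      using that by (auto intro: always_eventually less_le_trans tail_ratio_nonneg)
  qed (use lt in simp)
qed

end

section \<open>Reduction of the theorem to the abstract setting\<close>

lemma lattice_of_log_distr:
  assumes "prob_space M" and [measurable]: "A \<in> borel_measurable M" and nonneg: "AE \<omega> in M. A \<omega> \<ge> 0"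
    and lattice: "arithmetic_span (log_distr_nonzero M A) h"
  shows "AE \<omega> in M. A \<omega> = 0 \<or> (\<exists>k::int. A \<omega> = exp (of_int k * h))"
proof -
  interpret prob_space M by fact
  let ?S = "{\<omega> \<in> space M. A \<omega> \<noteq> 0}"
  show ?thesis
  proof (cases "emeasure M ?S = 0")
    case True
    \<comment> \<open>Conditioning on a null event carries no information, but here \<open>A\<close>
      is 0 almost surely.\<close>
    hence "AE \<omega> in M. \<omega> \<notin> ?S" by (intro AE_not_in) (auto simp: null_sets_def)
    thus ?thesis using AE_space by eventually_elim auto
  next
    case False
    have "AE y in log_distr_nonzero M A. \<exists>k::int. y = of_int k * h"
      using lattice by (simp add: arithmetic_span_def concentrated_on_lattice_def)
    hence "AE \<omega> in uniform_measure M ?S. \<exists>k::int. ln (A \<omega>) = of_int k * h"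
      unfolding log_distr_nonzero_def by (rule AE_distrD[rotated]) measurable
    hence "AE \<omega> in M. \<omega> \<in> ?S \<longrightarrow> (\<exists>k::int. ln (A \<omega>) = of_int k * h)"
      using False by (subst (asm) AE_uniform_measure) (auto simp: less_top[symmetric])
    thus ?thesis using nonneg AE_space
    proof eventually_elim
      case (elim \<omega>)
      show ?case
      proof (cases "A \<omega> = 0")
        case False
        then obtain k :: int where "ln (A \<omega>) = of_int k * h" using elim by auto
        hence "A \<omega> = exp (of_int k * h)" using False elim exp_ln[of "A \<omega>"] by simp
        thus ?thesis by blast
      qed simp
    qed
  qed
qed

lemma perpetuity_solution_uminus:
  assumes "perpetuity_solution M A B N X"
    and [measurable]: "A \<in> borel_measurable M" "B \<in> borel_measurable M"
  shows "perpetuity_solution M A (\<lambda>\<omega>. - B \<omega>) N (\<lambda>\<eta>. - X \<eta>)"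
proof -
  have [measurable]: "X \<in> borel_measurable N"
    and eq: "distr N borel X = distr (M \<Otimes>\<^sub>M N) borel (\<lambda>(\<omega>, \<eta>). A \<omega> * X \<eta> + B \<omega>)"
    using assms(1) by (auto simp: perpetuity_solution_def)
  have "distr N borel (\<lambda>\<eta>. - X \<eta>) = distr (distr N borel X) borel uminus"
    by (subst distr_distr) (auto simp: comp_def)
  also have "\<dots> = distr (M \<Otimes>\<^sub>M N) borel (\<lambda>(\<omega>, \<eta>). A \<omega> * (- X \<eta>) + - B \<omega>)"
    unfolding eq by (subst distr_distr) (auto simp: comp_def case_prod_unfold)
  finally show ?thesis by (simp add: perpetuity_solution_def)
qed

theorem theorem9:
  fixes M :: "'a measure" and N :: "'b measure"
    and A B :: "'a \<Rightarrow> real" and X :: "'b \<Rightarrow> real"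
    and \<kappa> h \<theta> \<nu> :: real and p :: "int \<Rightarrow> real"
  assumes "\<kappa> > 0" and "h > 0"
    and "prob_space M" and "A \<in> borel_measurable M" and "B \<in> borel_measurable M"
    and "AE \<omega> in M. A \<omega> \<ge> 0"
    and "integrable M (\<lambda>\<omega>. A \<omega> powr \<kappa>)"
    and "(\<integral>\<omega>. A \<omega> powr \<kappa> \<partial>M) = \<theta>" and "0 < \<theta>" and "\<theta> < 1"
    and "arithmetic_span (log_distr_nonzero M A) h"
    and p_def: "\<And>k. p k = lattice_mass h (tilted_cdf M A \<kappa>) k"
    and "lattice_subexponential h (tilted_cdf M A \<kappa>)"
    and "(\<lambda>n::nat. SUP k\<in>{n..}. p (int k)) \<in> O(\<lambda>n. p (int n))"
    and "\<nu> > \<kappa>" and "integrable M (\<lambda>\<omega>. \<bar>B \<omega>\<bar> powr \<nu>)"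
    and "prob_space N" and "perpetuity_solution M A B N X"
  shows "\<exists>q1\<in>Q_class \<kappa> h. \<exists>q2\<in>Q_class \<kappa> h.
     (\<forall>x\<in>continuity_points q1.
        (\<lambda>n::nat. inverse (p (int n)) * x powr \<kappa> * exp (\<kappa> * real n * h) *
           measure N {\<eta> \<in> space N. X \<eta> > x * exp (real n * h)}) \<longlonglongrightarrow> q1 x) \<and>
     (\<forall>x\<in>continuity_points q2.
        (\<lambda>n::nat. inverse (p (int n)) * x powr \<kappa> * exp (\<kappa> * real n * h) *
           measure N {\<eta> \<in> space N. X \<eta> < - (x * exp (real n * h))}) \<longlonglongrightarrow> q2 x) \<and>
     ((\<forall>x::real. measure M {\<omega> \<in> space M. A \<omega> * x + B \<omega> = x} < 1) \<longrightarrow>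
        (\<forall>x>0. q1 x + q2 x > 0))"
proof -
  interpret M: prob_space M by fact
  interpret N: prob_space N by fact
  have lattice: "AE \<omega> in M. A \<omega> = 0 \<or> (\<exists>k::int. A \<omega> = exp (of_int k * h))"
    using assms by (intro lattice_of_log_distr)
  interpret tilted_lattice M A \<kappa> h \<theta>
    using assms lattice by unfold_locales auto
  have p: "p = mass" using p_def lattice_mass_tilted_cdf by (simp add: fun_eq_iff)
  have sub: "(\<lambda>n::nat. mass (int (n + 1)) / mass (int n)) \<longlonglongrightarrow> 1"
    "(\<lambda>n::nat. (\<integral>j. mass (int n - j) * mass j \<partial>count_space UNIV) / mass (int n)) \<longlonglongrightarrow> 2"
    using \<open>lattice_subexponential h (tilted_cdf M A \<kappa>)\<close>
    unfolding lattice_subexponential_def lattice_mass_tilted_cdf lattice_mass_convolution by auto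
  obtain C where C: "\<forall>\<^sub>F n in sequentially. norm (SUP k\<in>{n..}. mass (int k)) \<le> C * norm (mass (int n))"
    using \<open>(\<lambda>n::nat. SUP k\<in>{n..}. p (int k)) \<in> O(\<lambda>n. p (int n))\<close> unfolding p by (elim landau_o.bigE)
  have dom: "\<forall>\<^sub>F n in sequentially. \<forall>k\<ge>n. mass (int k) \<le> C * mass (int n)"
    using C
  proof eventually_elim
    case (elim n)
    show ?case
    proof (intro allI impI)
      fix k assume "k \<ge> n"
      \<comment> \<open>A real supremum dominates its family only when the family is bounded above;
        masses are at most 1.\<close>
      have "bdd_above ((\<lambda>k. mass (int k)) ` {n..})"
        by (intro bdd_aboveI[of _ 1]) (auto simp: mass_def)
      with \<open>k \<ge> n\<close> have "mass (int k) \<le> (SUP k\<in>{n..}. mass (int k))" by (intro cSUP_upper) auto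
      thus "mass (int k) \<le> C * mass (int n)" using elim mass_nonneg[of "int n"] by simp
    qed
  qed
  \<comment> \<open>Stated for a general pair, as it serves both for \<open>B\<close>,
    \<open>X\<close> and for their negatives; the masses depend on \<open>A\<close> alone and are
    shared.\<close>
  have perp: "subexponential_perpetuity M A \<kappa> h \<theta> N B' X' \<nu> C"
    if "B' \<in> borel_measurable M" "integrable M (\<lambda>\<omega>. \<bar>B' \<omega>\<bar> powr \<nu>)" "perpetuity_solution M A B' N X'"
    for B' X'
    using that \<open>\<theta> < 1\<close> \<open>\<nu> > \<kappa>\<close> sub dom by unfold_locales (auto simp: mass_nonneg mass_integrable mass_total)
  interpret pos: subexponential_perpetuity M A \<kappa> h \<theta> N B X \<nu> C
    using assms by (intro perp)
  interpret neg: subexponential_perpetuity M A \<kappa> h \<theta> N "\<lambda>\<omega>. - B \<omega>" "\<lambda>\<eta>. - X \<eta>" \<nu> C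
    using assms by (intro perp perpetuity_solution_uminus) auto
  have positive: "pos.tail_profile x + neg.tail_profile x > 0"
    if B: "\<forall>x::real. measure M {\<omega> \<in> space M. A \<omega> * x + B \<omega> = x} < 1" and x: "x > 0" for x
  proof (rule ccontr)
    have nn: "pos.tail_profile x \<ge> 0" "neg.tail_profile x \<ge> 0"
      using pos.tail_profile_Q_class neg.tail_profile_Q_class x by (auto simp: Q_class_def)
    assume "\<not> pos.tail_profile x + neg.tail_profile x > 0"
    with nn have "pos.tail_profile x = 0" "neg.tail_profile x = 0" by linarith+
    hence "(\<lambda>n. pos.tail_ratio n x + neg.tail_ratio n x) \<longlonglongrightarrow> 0 + 0"
      by (intro tendsto_add pos.tail_ratio_tendsto_0 neg.tail_ratio_tendsto_0 x)
    \<comment> \<open>Nondegeneracy at the point 0 says that \<open>B\<close> is not almost surely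
      0, which keeps \<open>X\<close> away from the zero solution.\<close>
    moreover have "M.prob {\<omega> \<in> space M. B \<omega> = 0} < 1" using B[rule_format, of 0] by simp
    from pos.absolute_tail_lower_bound[OF this x] obtain c where c: "c > 0"
      "\<forall>\<^sub>F n in sequentially. c \<le> inverse (mass (int n)) * exp (\<kappa> * real n * h) *
         N.prob {\<eta> \<in> space N. \<bar>X \<eta>\<bar> > x * exp (real n * h)}" by blast
    moreover have "inverse (mass (int n)) * exp (\<kappa> * real n * h) *
         N.prob {\<eta> \<in> space N. \<bar>X \<eta>\<bar> > x * exp (real n * h)} \<le> pos.tail_ratio n x + neg.tail_ratio n x" for n
    proof -
      let ?u = "x * exp (real n * h)"
      have "N.prob {\<eta> \<in> space N. \<bar>X \<eta>\<bar> > ?u} \<le>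
         N.prob ({\<eta> \<in> space N. X \<eta> > ?u} \<union> {\<eta> \<in> space N. - X \<eta> > ?u})"
        by (intro N.finite_measure_mono) (auto simp: abs_if split: if_splits)
      also have "\<dots> \<le> N.prob {\<eta> \<in> space N. X \<eta> > ?u} + N.prob {\<eta> \<in> space N. - X \<eta> > ?u}"
        by (rule measure_Un_le) measurable
      finally show ?thesis
        unfolding pos.tail_ratio_def neg.tail_ratio_def distrib_left[symmetric]
        by (intro mult_left_mono) (auto simp: mass_nonneg)
    qed
    ultimately have "\<forall>\<^sub>F n in sequentially. c \<le> pos.tail_ratio n x + neg.tail_ratio n x"
      by (auto elim!: eventually_mono intro: order_trans)
    from tendsto_lowerbound[OF \<open>(\<lambda>n. pos.tail_ratio n x + neg.tail_ratio n x) \<longlonglongrightarrow> 0 + 0\<close> this]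
    show False using c by simp
  qed
  have "(\<lambda>n. inverse (p (int n)) * x powr \<kappa> * exp (\<kappa> * real n * h) *
      measure N {\<eta> \<in> space N. X \<eta> > x * exp (real n * h)}) \<longlonglongrightarrow> pos.tail_profile x"
    if "x \<in> continuity_points pos.tail_profile" for x
    using pos.tail_profile_limit[OF that] unfolding pos.tail_ratio_def p by (simp add: mult_ac)
  moreover have "(\<lambda>n. inverse (p (int n)) * x powr \<kappa> * exp (\<kappa> * real n * h) *
      measure N {\<eta> \<in> space N. X \<eta> < - (x * exp (real n * h))}) \<longlonglongrightarrow> neg.tail_profile x"
    if "x \<in> continuity_points neg.tail_profile" for x
  proof -
    have "u < - X \<eta> \<longleftrightarrow> X \<eta> < - u" for u \<eta> by auto
    thus ?thesis
      using neg.tail_profile_limit[OF that] unfolding neg.tail_ratio_def p by (simp add: mult_ac)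
  qed
  ultimately show ?thesis
    using pos.tail_profile_Q_class neg.tail_profile_Q_class positive by blast
qed

end
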